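(* Let $\mathbf{P}$ denote the Petersen graph. Then $\mathrm{exp}(\mathbf{P}) \le \frac{2}{3}$.
   Context: Graphs are finite and simple. The Petersen graph is the 10-vertex 3-regular graph whose vertices are the 2-element subsets of $\{1,2,3,4,5\}$, two being adjacent iff they are disjoint. For a graph $G$ and $X,Y\subset V(G)$, $e(X,Y)$ is the number of edges of $G$ with one vertex in $X$ and one vertex in $Y$, where edges with both vertices in $X\cap Y$ are counted twice. For real numbers $p\in[0,1]$ and $\alpha\ge 0$, $G$ is $(p,\alpha)$-jumbled if $\left|e(X,Y)-p|X||Y|\right|\le \alpha\sqrt{|X||Y|}$ for all $X,Y\subset V(G)$. A graph is $\mathcal{F}$-free, for a family $\mathcal{F}$ of graphs, if it contains no member of $\mathcal{F}$ as a (not necessarily induced) subgraph. For $C>0$, $\mathrm{ex}_{\mathrm{rand}}(n,C,\mathcal{F})$ is the maximum number of edges in an $n$-vertex $\mathcal{F}$-free graph that is $(p,\alpha)$-jumbled for some $p\in[0,1]$ and some $\alpha\ge 0$ with $\alpha\le C\sqrt{np}$ (there is no restriction on $p$). Define $$\mathrm{exp}(\mathcal{F})=\lim_{C\to\infty}\limsup_{n\to\infty}\frac{\log\left(\mathrm{ex}_{\mathrm{rand}}(n,C,\mathcal{F})/n\right)}{\log n},$$ and write $\mathrm{exp}(F)=\mathrm{exp}(\{F\})$. *)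

theory Defs
  imports "HOL-Analysis.Analysis"
begin

record 'a ugraph =
  verts :: "'a set"
  edges :: "'a set set"

definition simple_graph :: "'a ugraph \<Rightarrow> bool" where
  "simple_graph G \<longleftrightarrow> finite (verts G) \<and> (\<forall>e\<in>edges G. e \<subseteq> verts G \<and> card e = 2)"

definition petersen :: "nat set ugraph" where
  "petersen =
    \<lparr>verts = {A. A \<subseteq> {1..5} \<and> card A = 2},
     edges = {{A, B} | A B. A \<subseteq> {1..5} \<and> card A = 2 \<and> B \<subseteq> {1..5} \<and> card B = 2 \<and> A \<inter> B = {}}\<rparr>"

text \<open>The second summand is the extra count of the edges with both vertices in the intersection.\<close>
definition edges_between :: "'a ugraph \<Rightarrow> 'a set \<Rightarrow> 'a set \<Rightarrow> nat" where
  "edges_between G X Y =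
    card {e \<in> edges G. \<exists>x\<in>X. \<exists>y\<in>Y. e = {x, y}} + card {e \<in> edges G. e \<subseteq> X \<inter> Y}"

definition jumbled :: "'a ugraph \<Rightarrow> real \<Rightarrow> real \<Rightarrow> bool" where
  "jumbled G p \<alpha> \<longleftrightarrow>
    (\<forall>X Y. X \<subseteq> verts G \<longrightarrow> Y \<subseteq> verts G \<longrightarrow>
      \<bar>real (edges_between G X Y) - p * real (card X) * real (card Y)\<bar>
        \<le> \<alpha> * sqrt (real (card X) * real (card Y)))"

text \<open>Containment as a not necessarily induced subgraph, up to isomorphism.\<close>
definition contains_subgraph :: "'a ugraph \<Rightarrow> 'b ugraph \<Rightarrow> bool" where
  "contains_subgraph G H \<longleftrightarrow>
    (\<exists>f. inj_on f (verts H) \<and> f ` verts H \<subseteq> verts G \<and> (\<forall>e\<in>edges H. f ` e \<in> edges G))"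

definition free_of :: "'a ugraph \<Rightarrow> 'b ugraph set \<Rightarrow> bool" where
  "free_of G \<F> \<longleftrightarrow> (\<forall>H\<in>\<F>. \<not> contains_subgraph G H)"

text \<open>Every finite graph has an isomorphic copy on natural numbers, so quantifying over graphs
  with vertices in \<^typ>\<open>nat\<close> loses nothing. The maximum is over a finite set, which is
  nonempty when every member of the family has an edge: the graph without edges
  is \<open>(0, 0)\<close>-jumbled.\<close>
definition ex_rand :: "nat \<Rightarrow> real \<Rightarrow> 'b ugraph set \<Rightarrow> nat" where
  "ex_rand n C \<F> =
    Max {card (edges G) | G :: nat ugraph.
      simple_graph G \<and> card (verts G) = n \<and> free_of G \<F> \<and>
      (\<exists>p \<alpha>. 0 \<le> p \<and> p \<le> 1 \<and> 0 \<le> \<alpha> \<and> \<alpha> \<le> C * sqrt (real n * p) \<and> jumbled G p \<alpha>)}"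

text \<open>The logarithm of a nonnegative real, with \<open>log 0 = -\<infinity>\<close>; \<^term>\<open>ln (0::real) = 0\<close> would
  be wrong when \<^const>\<open>ex_rand\<close> vanishes, as it may for small \<open>C\<close>.\<close>
definition ext_log :: "real \<Rightarrow> ereal" where
  "ext_log x = (if x \<le> 0 then -\<infinity> else ereal (ln x))"

definition rand_exponent_at :: "real \<Rightarrow> 'b ugraph set \<Rightarrow> ereal" where
  "rand_exponent_at C \<F> =
    limsup (\<lambda>n. ext_log (real (ex_rand n C \<F>) / real n) / ereal (ln (real n)))"

text \<open>The exponent \<open>exp(\<F>)\<close>; the limit exists by \<open>tendsto_rand_exponent\<close> below.\<close>
definition rand_exponent :: "'b ugraph set \<Rightarrow> ereal" where
  "rand_exponent \<F> = Lim at_top (\<lambda>C. rand_exponent_at C \<F>)"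

lemma ex_rand_mono:
  fixes \<F> :: "'b ugraph set"
  assumes "C \<le> D"
  shows "ex_rand n C \<F> \<le> ex_rand n D \<F>"
proof -
  define Q where "Q = (\<lambda>C (G :: nat ugraph). simple_graph G \<and> card (verts G) = n \<and> free_of G \<F> \<and>
      (\<exists>p \<alpha>. 0 \<le> p \<and> p \<le> 1 \<and> 0 \<le> \<alpha> \<and> \<alpha> \<le> C * sqrt (real n * p) \<and> jumbled G p \<alpha>))"
  have ex: "ex_rand n C \<F> = Max {card (edges G) | G. Q C G}" for C
    by (simp add: ex_rand_def Q_def)
  have QQ: "Q D G" if "Q C G" for G
  proof -
    have "C * sqrt (real n * p) \<le> D * sqrt (real n * p)" if "0 \<le> p" for p
      using assms that by (intro mult_right_mono) auto
    then show ?thesis using \<open>Q C G\<close> unfolding Q_def by (meson order_trans)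
  qed
  have "card (edges G) \<le> 2 ^ n" if "Q D G" for G
  proof -
    have "finite (verts G)" "edges G \<subseteq> Pow (verts G)" "card (verts G) = n"
      using that by (auto simp: Q_def simple_graph_def)
    then show ?thesis by (metis card_Pow card_mono finite_Pow_iff)
  qed
  then have "{card (edges G) | G. Q D G} \<subseteq> {..2 ^ n}" by auto
  then have fin: "finite {card (edges G) | G. Q D G}"
    by (rule finite_subset) simp
  show ?thesis
  proof (cases "\<exists>G. Q D G")
    case False
    then have "{card (edges G) | G. Q C G} = {card (edges G) | G. Q D G}"
      using QQ by auto
    then show ?thesis by (simp add: ex)
  next
    case True
    then obtain G where G: "Q D G" by blast
    define G0 where "G0 = G\<lparr>edges := {}\<rparr>"
    have [simp]: "verts G0 = verts G" "edges G0 = {}" by (simp_all add: G0_def)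
    have "contains_subgraph G H" if "contains_subgraph G0 H" for H :: "'b ugraph"
      using that unfolding contains_subgraph_def by auto
    then have "free_of G0 \<F>"
      using G unfolding Q_def free_of_def by blast
    moreover have "jumbled G0 0 0"
      by (simp add: jumbled_def edges_between_def)
    then have "\<exists>p \<alpha>. 0 \<le> p \<and> p \<le> 1 \<and> 0 \<le> \<alpha> \<and> \<alpha> \<le> C * sqrt (real n * p) \<and> jumbled G0 p \<alpha>"
      by (intro exI[of _ 0]) simp
    moreover have "simple_graph G0" "card (verts G0) = n"
      using G by (simp_all add: Q_def simple_graph_def)
    ultimately have "Q C G0" unfolding Q_def by blast
    then have "{card (edges G) | G. Q C G} \<noteq> {}" by blast
    then show ?thesis unfolding ex
      using fin QQ by (intro Max_mono) auto
  qed
qed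

lemma rand_exponent_at_mono:
  assumes "C \<le> D"
  shows "rand_exponent_at C \<F> \<le> rand_exponent_at D \<F>"
  unfolding rand_exponent_at_def
proof (rule Limsup_mono, rule eventually_mono[OF eventually_gt_at_top[of "1::nat"]])
  fix n :: nat
  assume n: "1 < n"
  have ext: "ext_log x \<le> ext_log y" if "x \<le> y" for x y
    using that by (auto simp: ext_log_def)
  have "ext_log (real (ex_rand n C \<F>) / real n) \<le> ext_log (real (ex_rand n D \<F>) / real n)"
    using ex_rand_mono[OF assms] by (intro ext divide_right_mono) auto
  moreover have "0 < ln (real n)" using n by simp
  ultimately show "ext_log (real (ex_rand n C \<F>) / real n) / ereal (ln (real n))
      \<le> ext_log (real (ex_rand n D \<F>) / real n) / ereal (ln (real n))"
    by (intro ereal_divide_right_mono) auto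
qed

lemma tendsto_rand_exponent:
  "((\<lambda>C. rand_exponent_at C \<F>) \<longlongrightarrow> rand_exponent \<F>) at_top"
proof -
  have "((\<lambda>C. rand_exponent_at C \<F>) \<longlongrightarrow> (SUP C. rand_exponent_at C \<F>)) at_top"
  proof (rule increasing_tendsto)
    show "\<forall>\<^sub>F C in at_top. rand_exponent_at C \<F> \<le> (SUP C. rand_exponent_at C \<F>)"
      by (intro always_eventually allI SUP_upper) auto
    fix x assume "x < (SUP C. rand_exponent_at C \<F>)"
    then obtain C where "x < rand_exponent_at C \<F>" by (auto simp: less_SUP_iff)
    then show "\<forall>\<^sub>F C in at_top. x < rand_exponent_at C \<F>"
      by (intro eventually_mono[OF eventually_ge_at_top[of C]])
        (rule less_le_trans[OF _ rand_exponent_at_mono])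
  qed
  then show ?thesis
    using tendsto_Lim[OF trivial_limit_at_top_linorder] unfolding rand_exponent_def by metis
qed

end

(* The Petersen graph is the union of a pentagon x_0 ... x_4, a pentagram y_0 ... y_4 and the perfect
   matching x_i y_i. Fix ten disjoint blocks of size m = n div 10, one for each vertex, let F and
   G be families of pentagons and pentagrams (with the right block for each vertex) and A the
   adjacency matrix. Write A = p + M and expand the number of linked pairs
     sum over x in F, y in G of prod_i A(x_i, y_i)
   over the set S of indices at which M is chosen. Jumbledness bounds the operator norm of M by
   L = O(alpha log n), and the norms of tensor powers multiply, so the S-term is at most
   p^(5-|S|) L^|S| |f_S| |g_S|, where f_S (respectively g_S) counts the extensions of a partial
   pentagon. If vertices of atypically large degree are discarded, connectivity of the pentagon
   gives f_S <= (2pm)^(5-|S|). Together with |F|, |G| >= c (pm)^5, every term with S nonempty is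
   dominated by the main term as soon as L is a small multiple of p^2 m, that is,
   p >= n^(-1/3 + delta). A smaller p allows only O(n^(5/3 + delta)) edges. *)

theory Submission
  imports Defs "HOL-Real_Asymp.Real_Asymp"
begin

section \<open>Operator norm bound from discrepancy\<close>

text \<open>The smallest of \<open>k\<close> values is at most \<open>\<beta> / sqrt k\<close>; remove it and repeat.\<close>
lemma sum_squares_le_harm_nonneg:
  fixes b :: "'a \<Rightarrow> real"
  assumes "finite X" "\<And>x. x \<in> X \<Longrightarrow> 0 \<le> b x"
    and "\<And>Y. Y \<subseteq> X \<Longrightarrow> sum b Y \<le> \<beta> * sqrt (card Y)"
  shows "(\<Sum>x\<in>X. (b x)\<^sup>2) \<le> \<beta>\<^sup>2 * harm (card X)"
  using assms
proof (induction "card X" arbitrary: X)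
  case 0
  then show ?case by (simp add: harm_def)
next
  case (Suc k)
  then have "X \<noteq> {}" by auto
  then obtain z where z: "z \<in> X" "b z = Min (b ` X)"
    using Min_in[of "b ` X"] \<open>finite X\<close> by fastforce
  have le: "b z \<le> b x" if "x \<in> X" for x
    using that z(2) \<open>finite X\<close> by simp
  have "real (card X) * b z \<le> sum b X"
    using sum_bounded_below[of X "b z" b] le by simp
  also have "\<dots> \<le> \<beta> * sqrt (card X)" using Suc.prems(3) by blast
  finally have "(real (card X) * b z)\<^sup>2 \<le> (\<beta> * sqrt (card X))\<^sup>2"
    using Suc.prems(2)[OF z(1)] by (intro power_mono) auto
  then have "(b z)\<^sup>2 \<le> \<beta>\<^sup>2 * inverse (real (card X))"
    using Suc(2) by (simp add: power_mult_distrib field_simps power2_eq_square del: of_nat_Suc)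
  moreover have "(\<Sum>x\<in>X - {z}. (b x)\<^sup>2) \<le> \<beta>\<^sup>2 * harm (card (X - {z}))"
    using Suc.prems Suc.hyps z by (intro Suc.hyps(1)) auto
  moreover have "card (X - {z}) = k" using Suc.hyps(2) z(1) Suc.prems(1) by simp
  ultimately show ?case
    using Suc.hyps(2)[symmetric] z(1) Suc.prems(1)
    by (simp add: sum.remove[of X z] harm_Suc algebra_simps)
qed

text \<open>Splitting \<open>X\<close> by the sign of \<open>b\<close> leaves two sets on which the
  nonnegative bound applies, to \<open>b\<close> and to \<open>- b\<close>; the factor 2 accounts
  for the two parts.\<close>

lemma sum_squares_le_harm:
  fixes b :: "'a \<Rightarrow> real"
  assumes "finite X" "card X \<le> N"
    and b: "\<And>Y. Y \<subseteq> X \<Longrightarrow> \<bar>sum b Y\<bar> \<le> \<beta> * sqrt (card Y)"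
  shows "(\<Sum>x\<in>X. (b x)\<^sup>2) \<le> 2 * \<beta>\<^sup>2 * harm N"
proof -
  define P where "P = {x \<in> X. 0 \<le> b x}"
  have P: "P \<subseteq> X" by (auto simp: P_def)
  have N: "card P \<le> N" "card (X - P) \<le> N"
    using assms(1,2) P card_mono[of X P] card_mono[of X "X - P"] by auto
  have "(\<Sum>x\<in>P. (b x)\<^sup>2) \<le> \<beta>\<^sup>2 * harm (card P)"
  proof (rule sum_squares_le_harm_nonneg)
    show "sum b Y \<le> \<beta> * sqrt (card Y)" if "Y \<subseteq> P" for Y
      using b[of Y] that P by fastforce
  qed (use assms(1) P finite_subset in \<open>auto simp: P_def\<close>)
  moreover have "(\<Sum>x\<in>X - P. (- b x)\<^sup>2) \<le> \<beta>\<^sup>2 * harm (card (X - P))"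
  proof (rule sum_squares_le_harm_nonneg)
    show "(\<Sum>x\<in>Y. - b x) \<le> \<beta> * sqrt (card Y)" if "Y \<subseteq> X - P" for Y
      using b[of Y] that P unfolding sum_negf by fastforce
  qed (use assms(1) in \<open>auto simp: P_def\<close>)
  moreover have "\<beta>\<^sup>2 * harm (card P) \<le> \<beta>\<^sup>2 * harm N" "\<beta>\<^sup>2 * harm (card (X - P)) \<le> \<beta>\<^sup>2 * harm N"
    using N by (auto intro!: mult_left_mono harm_mono)
  ultimately show ?thesis
    using sum.subset_diff[OF P \<open>finite X\<close>, of "\<lambda>x. (b x)\<^sup>2"] by simp
qed

text \<open>Discrepancy controls the bilinear form on indicator functions only. The square-sum bound
  upgrades this to arbitrary vectors one side at a time: first for the row sums over a fixed
  \<open>Y'\<close>, then, after Cauchy-Schwarz against \<open>u\<close>, for the image of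
  \<open>u\<close>. Each of the two uses contributes a factor \<open>2 * harm N\<close> to the
  squared norm.\<close>

lemma operator_norm_le:
  fixes M :: "'a \<Rightarrow> 'b \<Rightarrow> real"
  assumes "finite X" "finite Y" "card X \<le> N" "card Y \<le> N"
    and M: "\<And>X' Y'. X' \<subseteq> X \<Longrightarrow> Y' \<subseteq> Y \<Longrightarrow>
      \<bar>\<Sum>x\<in>X'. \<Sum>y\<in>Y'. M x y\<bar> \<le> \<alpha> * sqrt (real (card X') * real (card Y'))"
  shows "(\<Sum>y\<in>Y. (\<Sum>x\<in>X. u x * M x y)\<^sup>2) \<le> (2 * harm N * \<alpha>)\<^sup>2 * (\<Sum>x\<in>X. (u x)\<^sup>2)"
proof -
  have H: "0 \<le> (harm N :: real)" by (rule harm_nonneg)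
  define \<beta> where "\<beta> = sqrt (\<Sum>x\<in>X. (u x)\<^sup>2) * sqrt (2 * \<alpha>\<^sup>2 * harm N)"
  have "\<bar>\<Sum>y\<in>Y'. \<Sum>x\<in>X. u x * M x y\<bar> \<le> \<beta> * sqrt (card Y')" if "Y' \<subseteq> Y" for Y'
  proof -
    have row: "(\<Sum>x\<in>X. (\<Sum>y\<in>Y'. M x y)\<^sup>2) \<le> 2 * (\<alpha> * sqrt (card Y'))\<^sup>2 * harm N"
      using assms that
      by (intro sum_squares_le_harm) (auto simp: real_sqrt_mult algebra_simps)
    have "(\<Sum>y\<in>Y'. \<Sum>x\<in>X. u x * M x y) = (\<Sum>x\<in>X. u x * (\<Sum>y\<in>Y'. M x y))"
      by (subst sum.swap) (simp add: sum_distrib_left)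
    also have "\<bar>\<dots>\<bar> \<le> (\<Sum>x\<in>X. \<bar>u x\<bar> * \<bar>\<Sum>y\<in>Y'. M x y\<bar>)"
      by (rule order_trans[OF sum_abs]) (simp add: abs_mult)
    also have "\<dots> \<le> L2_set u X * L2_set (\<lambda>x. \<Sum>y\<in>Y'. M x y) X"
      by (rule L2_set_mult_ineq)
    also have "\<dots> \<le> sqrt (\<Sum>x\<in>X. (u x)\<^sup>2) * sqrt (2 * (\<alpha> * sqrt (card Y'))\<^sup>2 * harm N)"
      unfolding L2_set_def using row by (intro mult_left_mono) (auto intro: sum_nonneg)
    also have "\<dots> = \<beta> * sqrt (card Y')"
      by (simp add: \<beta>_def real_sqrt_mult power_mult_distrib)
    finally show ?thesis .
  qed
  then have "(\<Sum>y\<in>Y. (\<Sum>x\<in>X. u x * M x y)\<^sup>2) \<le> 2 * \<beta>\<^sup>2 * harm N"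
    using assms by (intro sum_squares_le_harm) auto
  also have "\<beta>\<^sup>2 = (\<Sum>x\<in>X. (u x)\<^sup>2) * (2 * \<alpha>\<^sup>2 * harm N)"
    using H by (simp add: \<beta>_def power_mult_distrib sum_nonneg)
  finally show ?thesis by (simp add: power2_eq_square algebra_simps)
qed

section \<open>Operator norms of tensor powers\<close>

lemma sum_PiE_insert:
  fixes f :: "('i \<Rightarrow> 'a) \<Rightarrow> 'c::comm_monoid_add"
  assumes "i \<notin> S"
  shows "(\<Sum>x\<in>PiE (insert i S) U. f x) = (\<Sum>u\<in>U i. \<Sum>a\<in>PiE S U. f (a(i := u)))"
  unfolding PiE_insert_eq
  by (subst sum.reindex[OF inj_combinator[OF assms]])
     (simp add: sum.cartesian_product case_prod_unfold)

text \<open>Induction on the set of coordinates. For fixed remaining outputs \<open>b\<close>, the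
  coordinate \<open>i\<close> is handled by the one-factor bound; the induction hypothesis is then
  applied, for each \<open>v\<close>, to the slice of \<open>\<phi>\<close> at
  \<open>i := v\<close>, which is why \<open>\<phi>\<close> is generalised.\<close>

lemma tensor_norm_le:
  fixes M :: "'a \<Rightarrow> 'b \<Rightarrow> real" and \<phi> :: "('i \<Rightarrow> 'a) \<Rightarrow> real"
  assumes "finite S" "\<And>i. i \<in> S \<Longrightarrow> finite (U i) \<and> finite (W i)"
    and "\<And>i u. i \<in> S \<Longrightarrow> (\<Sum>w\<in>W i. (\<Sum>x\<in>U i. u x * M x w)\<^sup>2) \<le> L\<^sup>2 * (\<Sum>x\<in>U i. (u x)\<^sup>2)"
  shows "(\<Sum>b\<in>PiE S W. (\<Sum>a\<in>PiE S U. \<phi> a * (\<Prod>i\<in>S. M (a i) (b i)))\<^sup>2)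
    \<le> L ^ (2 * card S) * (\<Sum>a\<in>PiE S U. (\<phi> a)\<^sup>2)"
  using assms
proof (induction S arbitrary: \<phi> rule: finite_induct)
  case empty
  then show ?case by simp
next
  case (insert i S)
  define T where "T = (\<lambda>v b. \<Sum>a\<in>PiE S U. \<phi> (a(i := v)) * (\<Prod>j\<in>S. M (a j) (b j)))"
  have eq: "(\<Sum>a\<in>PiE (insert i S) U. \<phi> a * (\<Prod>j\<in>insert i S. M (a j) ((b(i := w)) j)))
      = (\<Sum>v\<in>U i. T v b * M v w)" for b w
  proof -
    have "(\<Prod>j\<in>insert i S. M ((a(i := v)) j) ((b(i := w)) j)) = M v w * (\<Prod>j\<in>S. M (a j) (b j))" for a v
      using insert.hyps by (simp add: prod.insert) (intro disjI2 prod.cong, auto)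
    then show ?thesis
      unfolding sum_PiE_insert[OF insert.hyps(2)] T_def by (simp add: sum_distrib_left mult_ac)
  qed
  have "(\<Sum>b\<in>PiE (insert i S) W. (\<Sum>a\<in>PiE (insert i S) U. \<phi> a * (\<Prod>j\<in>insert i S. M (a j) (b j)))\<^sup>2)
      = (\<Sum>b\<in>PiE S W. \<Sum>w\<in>W i. (\<Sum>v\<in>U i. T v b * M v w)\<^sup>2)"
    by (subst sum_PiE_insert[OF insert.hyps(2)], subst sum.swap) (simp only: eq)
  also have "\<dots> \<le> (\<Sum>b\<in>PiE S W. L\<^sup>2 * (\<Sum>v\<in>U i. (T v b)\<^sup>2))"
    by (intro sum_mono insert.prems) simp
  also have "\<dots> = L\<^sup>2 * (\<Sum>v\<in>U i. \<Sum>b\<in>PiE S W. (T v b)\<^sup>2)"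
    by (subst sum.swap) (simp add: sum_distrib_left)
  also have "\<dots> \<le> L\<^sup>2 * (\<Sum>v\<in>U i. L ^ (2 * card S) * (\<Sum>a\<in>PiE S U. (\<phi> (a(i := v)))\<^sup>2))"
    unfolding T_def using insert.prems by (intro mult_left_mono sum_mono insert.IH) auto
  also have "\<dots> = L ^ (2 * card (insert i S)) * (\<Sum>a\<in>PiE (insert i S) U. (\<phi> a)\<^sup>2)"
    unfolding sum_PiE_insert[OF insert.hyps(2)] using insert.hyps
    by (simp add: sum_distrib_left[symmetric] power2_eq_square)
  finally show ?case .
qed

section \<open>Pentagons in pseudorandom graphs\<close>

text \<open>Discrepancy is stated for disjoint sets, where each edge between \<open>X\<close> and
  \<open>Y\<close> comes from exactly one pair and \<open>edges_between\<close> becomes a plain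
  double sum.\<close>

locale pseudorandom =
  fixes E :: "'a \<Rightarrow> 'a \<Rightarrow> bool" and V :: "'a set" and p \<alpha> :: real
  assumes finite_V: "finite V"
    and E_sym: "E x y \<Longrightarrow> E y x"
    and p_pos: "0 < p" and p_le_1: "p \<le> 1" and alpha_nonneg: "0 \<le> \<alpha>"
    and disc: "X \<subseteq> V \<Longrightarrow> Y \<subseteq> V \<Longrightarrow> X \<inter> Y = {} \<Longrightarrow>
      \<bar>(\<Sum>x\<in>X. \<Sum>y\<in>Y. of_bool (E x y)) - p * real (card X) * real (card Y)\<bar>
        \<le> \<alpha> * sqrt (real (card X) * real (card Y))"
begin

definition deg :: "'a \<Rightarrow> 'a set \<Rightarrow> real" where
  "deg x Y = (\<Sum>y\<in>Y. of_bool (E x y))"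

lemma deg_nonneg: "0 \<le> deg x Y"
  unfolding deg_def by (intro sum_nonneg) auto

lemma deg_mono: "Y \<subseteq> Y' \<Longrightarrow> finite Y' \<Longrightarrow> deg x Y \<le> deg x Y'"
  unfolding deg_def by (intro sum_mono2) auto

lemma deg_eq_card: "finite Y \<Longrightarrow> deg x Y = card {y \<in> Y. E x y}"
  unfolding deg_def by (simp add: Int_def flip: of_bool_def)

text \<open>The low-degree vertices \<open>B\<close> send at most half the expected number of edges
  to \<open>Y\<close>. With \<open>t^2 = card B * card Y\<close>, this deficit of at least
  \<open>p * t^2 / 2\<close> must stay within the permitted error
  \<open>\<alpha> * t\<close>.\<close>

lemma few_low_degree:
  assumes "X \<subseteq> V" "Y \<subseteq> V" "X \<inter> Y = {}"
  shows "p\<^sup>2 * real (card {x \<in> X. deg x Y < p * card Y / 2}) * real (card Y) \<le> 4 * \<alpha>\<^sup>2"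
proof -
  define B where "B = {x \<in> X. deg x Y < p * card Y / 2}"
  define t where "t = sqrt (real (card B) * real (card Y))"
  have t: "t\<^sup>2 = real (card B) * real (card Y)" "0 \<le> t" by (simp_all add: t_def)
  have B: "B \<subseteq> V" "B \<inter> Y = {}" using assms by (auto simp: B_def)
  have "p * real (card B) * real (card Y) - \<alpha> * t \<le> (\<Sum>x\<in>B. deg x Y)"
    using disc[OF B(1) assms(2) B(2)] unfolding t_def deg_def by linarith
  also have "\<dots> \<le> real (card B) * (p * card Y / 2)"
    using sum_bounded_above[of B "\<lambda>x. deg x Y" "p * card Y / 2"] by (auto simp: B_def)
  finally have "p * t\<^sup>2 / 2 \<le> \<alpha> * t" by (simp add: t algebra_simps)
  then have "p * t \<le> 2 * \<alpha>"
    using t(2) alpha_nonneg by (cases "t = 0") (auto simp: power2_eq_square)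
  then have "(p * t)\<^sup>2 \<le> (2 * \<alpha>)\<^sup>2" using p_pos t(2) by (intro power_mono) auto
  then show ?thesis by (simp add: power_mult_distrib t B_def)
qed

text \<open>The same argument with an excess: \<open>B\<close> sends at least twice the expected
  number of edges to \<open>Y\<close>, a surplus of at least \<open>p * t^2\<close>.\<close>

lemma few_high_degree:
  assumes "X \<subseteq> V" "Y \<subseteq> V" "X \<inter> Y = {}"
  shows "p\<^sup>2 * real (card {x \<in> X. 2 * p * card Y < deg x Y}) * real (card Y) \<le> \<alpha>\<^sup>2"
proof -
  define B where "B = {x \<in> X. 2 * p * card Y < deg x Y}"
  define t where "t = sqrt (real (card B) * real (card Y))"
  have t: "t\<^sup>2 = real (card B) * real (card Y)" "0 \<le> t" by (simp_all add: t_def)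
  have B: "B \<subseteq> V" "B \<inter> Y = {}" using assms by (auto simp: B_def)
  have "real (card B) * (2 * p * card Y) \<le> (\<Sum>x\<in>B. deg x Y)"
    using sum_bounded_below[of B "2 * p * card Y" "\<lambda>x. deg x Y"] by (auto simp: B_def)
  also have "\<dots> \<le> p * real (card B) * real (card Y) + \<alpha> * t"
    using disc[OF B(1) assms(2) B(2)] unfolding t_def deg_def by linarith
  finally have "p * t\<^sup>2 \<le> \<alpha> * t" by (simp add: t algebra_simps)
  then have "p * t \<le> \<alpha>"
    using t(2) alpha_nonneg by (cases "t = 0") (auto simp: power2_eq_square)
  then have "(p * t)\<^sup>2 \<le> \<alpha>\<^sup>2" using p_pos t(2) by (intro power_mono) auto
  then show ?thesis by (simp add: power_mult_distrib t B_def)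
qed

text \<open>The form in which \<open>few_low_degree\<close> is applied, both to whole blocks and to
  neighbourhoods, whose size bound \<open>s\<close> is smaller by a factor of order
  \<open>p\<close>.\<close>

lemma card_low_degree_le:
  assumes "X \<subseteq> V" "Y \<subseteq> V" "X \<inter> Y = {}" and Y: "s \<le> real (card Y)" and s: "0 < s"
    and small: "4 * \<alpha>\<^sup>2 \<le> p\<^sup>2 * s * r"
  shows "real (card {x \<in> X. deg x Y < p * card Y / 2}) \<le> r"
proof -
  let ?b = "real (card {x \<in> X. deg x Y < p * card Y / 2})"
  have "p\<^sup>2 * s * ?b \<le> p\<^sup>2 * ?b * real (card Y)"
    using mult_left_mono[OF Y, of "p\<^sup>2 * ?b"] by (simp add: mult_ac)
  also have "\<dots> \<le> p\<^sup>2 * s * r" using few_low_degree[OF assms(1-3)] small by (rule order_trans)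
  finally show ?thesis using p_pos s by (simp add: mult_le_cancel_left_pos)
qed

text \<open>With \<open>N1\<close> and \<open>N4\<close> the neighbourhoods of a vertex
  \<open>x0\<close> in two blocks, the sum counts the pentagons through \<open>x0\<close>. At least
  \<open>m / 4\<close> vertices of \<open>T2\<close> have typical degree into \<open>N1\<close>, and
  at least \<open>m / 4\<close> of \<open>T3\<close> into \<open>N4\<close>; between these there are
  at least \<open>p * m^2 / 32\<close> edges, each of weight at least
  \<open>(p^2 * m / 8)^2\<close>.\<close>

lemma path_sum_lower:
  fixes m :: real
  assumes sub: "N1 \<subseteq> V" "T2 \<subseteq> V" "T3 \<subseteq> V" "N4 \<subseteq> V"
    and disj: "T2 \<inter> N1 = {}" "T2 \<inter> T3 = {}" "T3 \<inter> N4 = {}"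
    and m: "0 < m" and small: "\<alpha> \<le> p\<^sup>2 * m / 8"
    and card: "p * m / 4 \<le> card N1" "p * m / 4 \<le> card N4" "m / 2 \<le> card T2" "m / 2 \<le> card T3"
  shows "p ^ 5 * m ^ 4 / 2048 \<le> (\<Sum>x\<in>T2. \<Sum>y\<in>T3. of_bool (E x y) * deg x N1 * deg y N4)"
proof -
  have fin: "finite T2" "finite T3" using sub by (auto intro: finite_subset[OF _ finite_V])
  \<comment> \<open>Smallness of \<open>\<alpha>\<close> gives
    \<open>4 * \<alpha>^2 <= p^4 * m^2 / 16\<close>, enough to leave at most \<open>m / 4\<close>
    vertices of low degree even towards sets of size only \<open>p * m / 4\<close>.\<close>
  have "4 * \<alpha>\<^sup>2 \<le> 4 * (p\<^sup>2 * m / 8)\<^sup>2"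
    using small alpha_nonneg by (intro mult_left_mono power_mono) auto
  also have "\<dots> = p\<^sup>2 * (p * m / 4) * (m / 4) * p"
    by (simp add: power2_eq_square)
  also have "\<dots> \<le> p\<^sup>2 * (p * m / 4) * (m / 4) * 1"
    using p_pos p_le_1 m by (intro mult_left_mono) auto
  finally have a: "4 * \<alpha>\<^sup>2 \<le> p\<^sup>2 * (p * m / 4) * (m / 4)" by simp
  have pm: "0 < p * m / 4" using p_pos m by simp
  define X where "X = {x \<in> T2. \<not> deg x N1 < p * card N1 / 2}"
  define Y where "Y = {x \<in> T3. \<not> deg x N4 < p * card N4 / 2}"
  have XY: "X \<subseteq> T2" "Y \<subseteq> T3" by (auto simp: X_def Y_def)
  have good: "m / 4 \<le> card {x \<in> T. \<not> deg x N < p * card N / 2}"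
    if "T \<subseteq> V" "N \<subseteq> V" "T \<inter> N = {}" "p * m / 4 \<le> card N" "m / 2 \<le> card T" for T N
  proof -
    have "finite T" using that by (auto intro: finite_subset[OF _ finite_V])
    then have "card T = card {x \<in> T. deg x N < p * card N / 2} + card {x \<in> T. \<not> deg x N < p * card N / 2}"
      by (subst card_Un_disjoint[symmetric]) (auto intro!: arg_cong[of _ _ card])
    then show ?thesis
      using card_low_degree_le[OF that(1-4) pm a] that(5) by linarith
  qed
  have XYV: "X \<subseteq> V" "Y \<subseteq> V" "X \<inter> Y = {}" using XY sub disj by blast+
  have cX: "m / 4 \<le> card X" and cY: "m / 4 \<le> card Y"
    unfolding X_def Y_def using good assms by auto
  define t where "t = sqrt (real (card X) * real (card Y))"
  have t2: "t\<^sup>2 = real (card X) * real (card Y)" by (simp add: t_def)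
  have "sqrt ((m / 4) * (m / 4)) \<le> t"
    unfolding t_def using cX cY m by (intro real_sqrt_le_mono mult_mono) auto
  moreover have "sqrt ((m / 4) * (m / 4)) = m / 4" using m unfolding real_sqrt_abs2 by simp
  ultimately have t: "m / 4 \<le> t" by simp
  \<comment> \<open>The error \<open>\<alpha> * t\<close> is thus at most half the main term
    \<open>p * t^2\<close>, so at least \<open>p * t^2 / 2\<close> edges remain between
    \<open>X\<close> and \<open>Y\<close>.\<close>
  have "\<alpha> \<le> p * t / 2"
  proof -
    have "p\<^sup>2 * m / 8 \<le> p * m / 8" using p_pos p_le_1 m by (simp add: power2_eq_square mult_left_le)
    moreover have "p * m / 8 \<le> p * t / 2" using t p_pos by simp
    ultimately show ?thesis using small by linarith
  qed
  then have "\<alpha> * t \<le> p * t\<^sup>2 / 2"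
    using t m mult_right_mono[of \<alpha> "p * t / 2" t] by (simp add: power2_eq_square mult_ac)
  moreover have "\<bar>(\<Sum>x\<in>X. \<Sum>y\<in>Y. of_bool (E x y)) - p * t\<^sup>2\<bar> \<le> \<alpha> * t"
    using disc[OF XYV] by (simp add: t_def t2[unfolded t_def] mult.assoc)
  moreover have "(m / 4)\<^sup>2 \<le> t\<^sup>2" using t m by (intro power_mono) auto
  then have "p * (m / 4)\<^sup>2 \<le> p * t\<^sup>2" using p_pos by simp
  ultimately have e: "p * m\<^sup>2 / 32 \<le> (\<Sum>x\<in>X. \<Sum>y\<in>Y. of_bool (E x y))"
    by (simp add: power_divide)
  have "p * (p * m / 4) \<le> p * card N1" "p * (p * m / 4) \<le> p * card N4"
    using mult_left_mono[OF card(1)] mult_left_mono[OF card(2)] p_pos by (simp_all only: less_imp_le)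
  then have N: "p\<^sup>2 * m / 8 \<le> p * card N1 / 2" "p\<^sup>2 * m / 8 \<le> p * card N4 / 2"
    by (simp_all add: power2_eq_square mult_ac)
  have dN: "p\<^sup>2 * m / 8 \<le> deg x N1" if "x \<in> X" for x
    by (rule order_trans[OF N(1)]) (use that in \<open>simp add: X_def not_less\<close>)
  have dN': "p\<^sup>2 * m / 8 \<le> deg x N4" if "x \<in> Y" for x
    by (rule order_trans[OF N(2)]) (use that in \<open>simp add: Y_def not_less\<close>)
  have "p ^ 5 * m ^ 4 / 2048 = (p * m\<^sup>2 / 32) * ((p\<^sup>2 * m / 8) * (p\<^sup>2 * m / 8))"
    by (simp add: power2_eq_square eval_nat_numeral)
  also have "\<dots> \<le> (\<Sum>x\<in>X. \<Sum>y\<in>Y. of_bool (E x y)) * ((p\<^sup>2 * m / 8) * (p\<^sup>2 * m / 8))"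
    using e by (intro mult_right_mono) auto
  also have "\<dots> = (\<Sum>x\<in>X. \<Sum>y\<in>Y. of_bool (E x y) * ((p\<^sup>2 * m / 8) * (p\<^sup>2 * m / 8)))"
    by (simp add: sum_distrib_right)
  also have "\<dots> \<le> (\<Sum>x\<in>X. \<Sum>y\<in>Y. of_bool (E x y) * (deg x N1 * deg y N4))"
    using dN dN' m by (intro sum_mono mult_left_mono mult_mono deg_nonneg) auto
  also have "\<dots> \<le> (\<Sum>x\<in>X. \<Sum>y\<in>T3. of_bool (E x y) * (deg x N1 * deg y N4))"
    using XY fin by (intro sum_mono sum_mono2) (auto intro!: mult_nonneg_nonneg deg_nonneg)
  also have "\<dots> \<le> (\<Sum>x\<in>T2. \<Sum>y\<in>T3. of_bool (E x y) * (deg x N1 * deg y N4))"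
    using XY fin by (intro sum_mono2) (auto intro!: sum_nonneg mult_nonneg_nonneg deg_nonneg)
  finally show ?thesis by (simp add: mult.assoc)
qed

text \<open>At least \<open>m / 4\<close> vertices \<open>x0\<close> of \<open>T0\<close> have
  typical degree into both \<open>T1\<close> and \<open>T4\<close>, hence neighbourhoods of size at
  least \<open>p * m / 4\<close> there. \<open>path_sum_lower\<close> counts the pentagons through
  each such \<open>x0\<close>, and 8192 is 4 times 2048.\<close>

lemma cycle_sum_lower:
  fixes m :: real
  assumes sub: "T0 \<subseteq> V" "T1 \<subseteq> V" "T2 \<subseteq> V" "T3 \<subseteq> V" "T4 \<subseteq> V"
    and disj: "T0 \<inter> T1 = {}" "T1 \<inter> T2 = {}" "T2 \<inter> T3 = {}" "T3 \<inter> T4 = {}" "T4 \<inter> T0 = {}"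
    and m: "0 < m" and small: "\<alpha> \<le> p\<^sup>2 * m / 8"
    and card: "m / 2 \<le> card T0" "m / 2 \<le> card T1" "m / 2 \<le> card T2" "m / 2 \<le> card T3" "m / 2 \<le> card T4"
  shows "p ^ 5 * m ^ 5 / 8192 \<le>
    (\<Sum>x0\<in>T0. \<Sum>x1\<in>T1. \<Sum>x2\<in>T2. \<Sum>x3\<in>T3. \<Sum>x4\<in>T4.
      of_bool (E x0 x1 \<and> E x1 x2 \<and> E x2 x3 \<and> E x3 x4 \<and> E x4 x0))"
proof -
  have fin: "finite T0" "finite T1" "finite T2" "finite T3" "finite T4"
    using sub by (auto intro: finite_subset[OF _ finite_V])
  define X1 where "X1 = {x \<in> T0. deg x T1 < p * card T1 / 2}"
  define X4 where "X4 = {x \<in> T0. deg x T4 < p * card T4 / 2}"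
  define X where "X = T0 - (X1 \<union> X4)"
  have "4 * \<alpha>\<^sup>2 \<le> 4 * (p\<^sup>2 * m / 8)\<^sup>2"
    using small alpha_nonneg by (intro mult_left_mono power_mono) auto
  also have "\<dots> = p\<^sup>2 * (m / 2) * (m / 8) * p\<^sup>2"
    by (simp add: power2_eq_square)
  also have "\<dots> \<le> p\<^sup>2 * (m / 2) * (m / 8) * 1"
    using p_pos p_le_1 m by (intro mult_left_mono) (auto simp: power_le_one)
  finally have a: "4 * \<alpha>\<^sup>2 \<le> p\<^sup>2 * (m / 2) * (m / 8)" by simp
  have "card X1 \<le> m / 8" "card X4 \<le> m / 8"
    unfolding X1_def X4_def using card_low_degree_le[OF _ _ _ _ _ a] sub disj card m by (auto simp: Int_commute)
  moreover have "real (card T0) - real (card X1 + card X4) \<le> card X"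
  proof -
    have "card T0 \<le> card X + (card X1 + card X4)"
      using card_Un_le[of X "X1 \<union> X4"] card_Un_le[of X1 X4] card_mono[of "X \<union> (X1 \<union> X4)" T0] fin
      by (auto simp: X_def X1_def X4_def)
    then show ?thesis by linarith
  qed
  ultimately have cX: "m / 4 \<le> card X" using card by simp
  have nb: "p * m / 4 \<le> card {y \<in> T1. E x y}" "p * m / 4 \<le> card {y \<in> T4. E x y}" if "x \<in> X" for x
  proof -
    have "p * (m / 2) \<le> p * card T1" "p * (m / 2) \<le> p * card T4"
      using card p_pos by (auto intro: mult_left_mono)
    moreover have "p * card T1 / 2 \<le> deg x T1" "p * card T4 / 2 \<le> deg x T4"
      using that by (auto simp: X_def X1_def X4_def)
    ultimately show "p * m / 4 \<le> card {y \<in> T1. E x y}" "p * m / 4 \<le> card {y \<in> T4. E x y}"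
      using fin by (simp_all add: deg_eq_card)
  qed
  \<comment> \<open>For fixed \<open>x0\<close> the sums over \<open>x1\<close> and
    \<open>x4\<close> factor into counts of common neighbours: \<open>x1\<close> is joined to
    \<open>x0\<close> and \<open>x2\<close>, while \<open>x4\<close> is joined to \<open>x0\<close>
    and \<open>x3\<close>.\<close>
  have inner: "(\<Sum>x1\<in>T1. \<Sum>x2\<in>T2. \<Sum>x3\<in>T3. \<Sum>x4\<in>T4.
        of_bool (E x0 x1 \<and> E x1 x2 \<and> E x2 x3 \<and> E x3 x4 \<and> E x4 x0)) =
      (\<Sum>x2\<in>T2. \<Sum>x3\<in>T3. of_bool (E x2 x3) * deg x2 {y \<in> T1. E x0 y} * deg x3 {y \<in> T4. E x0 y})"
    (is "?L = ?R") for x0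
  proof -
    have sw: "E u v = E v u" for u v using E_sym by blast
    have d: "deg x {y \<in> T. E x0 y} = (\<Sum>y\<in>T. of_bool (E x y \<and> E x0 y))" if "finite T" for x T
      unfolding deg_def using that by (intro sum.mono_neutral_cong_left) auto
    have "?L = (\<Sum>x2\<in>T2. \<Sum>x3\<in>T3. \<Sum>x1\<in>T1. \<Sum>x4\<in>T4.
        of_bool (E x0 x1 \<and> E x1 x2 \<and> E x2 x3 \<and> E x3 x4 \<and> E x4 x0))"
      by (subst sum.swap, rule sum.cong[OF refl], subst sum.swap) (rule refl)
    also have "\<dots> = (\<Sum>x2\<in>T2. \<Sum>x3\<in>T3. \<Sum>x1\<in>T1. \<Sum>x4\<in>T4.
        of_bool (E x2 x3) * (of_bool (E x2 x1 \<and> E x0 x1) * of_bool (E x3 x4 \<and> E x0 x4)))"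
      by (intro sum.cong refl) (auto simp: sw)
    also have "\<dots> = ?R"
      unfolding d[OF fin(2)] d[OF fin(5)]
      by (simp only: mult.assoc sum_product, simp only: sum_distrib_left)
    finally show ?thesis .
  qed
  have "p ^ 5 * m ^ 5 / 8192 = (m / 4) * (p ^ 5 * m ^ 4 / 2048)"
    by (simp add: eval_nat_numeral)
  also have "\<dots> \<le> real (card X) * (p ^ 5 * m ^ 4 / 2048)"
    using cX p_pos m by (intro mult_right_mono) auto
  also have "\<dots> \<le> (\<Sum>x0\<in>X. \<Sum>x2\<in>T2. \<Sum>x3\<in>T3.
      of_bool (E x2 x3) * deg x2 {y \<in> T1. E x0 y} * deg x3 {y \<in> T4. E x0 y})"
    using sub disj m small card by (intro sum_bounded_below path_sum_lower nb) auto
  also have "\<dots> \<le> (\<Sum>x0\<in>T0. \<Sum>x2\<in>T2. \<Sum>x3\<in>T3.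
      of_bool (E x2 x3) * deg x2 {y \<in> T1. E x0 y} * deg x3 {y \<in> T4. E x0 y})"
    using fin by (intro sum_mono2) (auto simp: X_def intro!: sum_nonneg mult_nonneg_nonneg deg_nonneg)
  finally show ?thesis by (simp only: inner)
qed

end

section \<open>Cyclic patterns and the extensions of partial ones\<close>

lemma all_less_5: "(\<forall>i<5::nat. P i) \<longleftrightarrow> P 0 \<and> P 1 \<and> P 2 \<and> P 3 \<and> P 4"
  by (simp add: eval_nat_numeral All_less_Suc conj_ac)

text \<open>Both 1 and 2 generate the integers modulo 5, so the orbit of a single index is
  everything. This is the connectivity of the pentagon and of the pentagram.\<close>

lemma eq_lessThan_5_if_closed:
  fixes S :: "nat set"
  assumes "S \<subseteq> {..<5}" "S \<noteq> {}" and closed: "\<And>i. i \<in> S \<Longrightarrow> (i + s) mod 5 \<in> S" and s: "s = 1 \<or> s = 2"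
  shows "S = {..<5}"
proof -
  obtain i where i: "i \<in> S" "i < 5" using assms by blast
  have orbit: "(i + k * s) mod 5 \<in> S" for k
  proof (induction k)
    case 0
    then show ?case using i by simp
  next
    case (Suc k)
    have "((i + k * s) mod 5 + s) mod 5 = (i + Suc k * s) mod 5"
      by (simp add: mod_simps add_ac)
    then show ?case using closed[OF Suc] by simp
  qed
  have "j \<in> S" if "j < 5" for j
  proof -
    \<comment> \<open>The added 5 keeps the difference \<open>d\<close> a natural number. From
      \<open>i\<close>, the index \<open>j\<close> is reached by \<open>d\<close> steps of length 1,
      or by \<open>3 * d\<close> steps of length 2 because 3 inverts 2 modulo 5.\<close>
    obtain d where d: "j + 5 = i + d" using i(2) le_Suc_ex[of i "j + 5"] by auto
    have "i + d * 1 = j + 1 * 5" "i + (3 * d) * 2 = j + (1 + d) * 5" using d by simp_all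
    then have "(i + d * 1) mod 5 = j" "(i + (3 * d) * 2) mod 5 = j"
      using that by (simp_all only: mod_mult_self1 mod_less)
    then show ?thesis using s orbit[of d] orbit[of "3 * d"] by auto
  qed
  then show ?thesis using assms(1) by blast
qed

context pseudorandom
begin

text \<open>The partial assignment is extended one coordinate at a time. Connectivity supplies a
  free coordinate \<open>j\<close> related to a fixed one \<open>i\<close>; its value is a neighbour
  of \<open>a i\<close> in \<open>T j\<close>, which leaves at most \<open>D\<close>
  choices.\<close>

lemma card_extensions_le:
  assumes "finite I" "finite F" "F \<subseteq> PiE I T" "\<And>i. i \<in> I \<Longrightarrow> finite (T i)"
    and connected: "\<And>S. S \<subseteq> I \<Longrightarrow> S \<noteq> {} \<Longrightarrow> S \<noteq> I \<Longrightarrow> \<exists>i\<in>S. \<exists>j\<in>I - S. R i j"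
    and edge: "\<And>x i j. x \<in> F \<Longrightarrow> i \<in> I \<Longrightarrow> j \<in> I \<Longrightarrow> R i j \<Longrightarrow> E (x i) (x j)"
    and deg: "\<And>v i j. i \<in> I \<Longrightarrow> j \<in> I \<Longrightarrow> i \<noteq> j \<Longrightarrow> v \<in> T i \<Longrightarrow> deg v (T j) \<le> D"
    and "0 \<le> D" "S \<subseteq> I" "S \<noteq> {}"
  shows "real (card {x \<in> F. restrict x S = a}) \<le> D ^ card (I - S)"
  using \<open>S \<subseteq> I\<close> \<open>S \<noteq> {}\<close>
proof (induction "card (I - S)" arbitrary: S a)
  case 0
  then have "S = I" using \<open>finite I\<close> by auto
  then have "{x \<in> F. restrict x S = a} \<subseteq> {a}"
    using assms(3) by (auto simp: PiE_restrict dest!: subsetD)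
  then have "card {x \<in> F. restrict x S = a} \<le> 1"
    using card_mono[of "{a}"] by fastforce
  then have "real (card {x \<in> F. restrict x S = a}) \<le> real 1" by (rule of_nat_mono)
  then show ?case unfolding 0(1)[symmetric] power_0 of_nat_1 .
next
  case (Suc k)
  then obtain i j where ij: "i \<in> S" "j \<in> I" "j \<notin> S" "R i j"
    using connected[of S] by (metis DiffE Diff_cancel card.empty nat.distinct(1))
  have iI: "i \<in> I" using ij Suc.prems by auto
  show ?case
  \<comment> \<open>Only a member of the fibre shows that \<open>a i\<close> lies in
    \<open>T i\<close>, where the degree bound is available.\<close>
  proof (cases "{x \<in> F. restrict x S = a} = {}")
    case True
    then show ?thesis unfolding True using \<open>0 \<le> D\<close> by simp
  next
    case False
    then obtain x where x: "x \<in> F" "restrict x S = a" by blast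
    have "a i = x i" using x ij by auto
    then have "a i \<in> T i" using x assms(3) iI by (auto simp: PiE_iff dest!: subsetD)
    define Nb where "Nb = {v \<in> T j. E (a i) v}"
    have "finite Nb" using assms(4) ij by (simp add: Nb_def)
    have Nb: "real (card Nb) \<le> D"
      using deg[OF iI ij(2) _ \<open>a i \<in> T i\<close>] ij deg_eq_card[of "T j" "a i"] assms(4)
      by (auto simp: Nb_def)
    have "{x \<in> F. restrict x S = a} \<subseteq> (\<Union>v\<in>Nb. {x \<in> F. restrict x (insert j S) = a(j := v)})"
    proof
      fix y assume "y \<in> {x \<in> F. restrict x S = a}"
      then have y: "y \<in> F" "restrict y S = a" by auto
      have "a i = y i" using y ij by auto
      then have "y j \<in> Nb"
        using edge[OF y(1) iI ij(2,4)] y(1) assms(3) ij by (auto simp: Nb_def PiE_iff dest!: subsetD)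
      moreover have "restrict y (insert j S) = a(j := y j)"
        using y(2) by (auto simp: fun_eq_iff restrict_def)
      ultimately show "y \<in> (\<Union>v\<in>Nb. {x \<in> F. restrict x (insert j S) = a(j := v)})"
        using y by blast
    qed
    then have "card {x \<in> F. restrict x S = a}
        \<le> card (\<Union>v\<in>Nb. {x \<in> F. restrict x (insert j S) = a(j := v)})"
      using \<open>finite Nb\<close> \<open>finite F\<close> by (intro card_mono) auto
    also have "\<dots> \<le> (\<Sum>v\<in>Nb. card {x \<in> F. restrict x (insert j S) = a(j := v)})"
      using \<open>finite Nb\<close> by (rule card_UN_le)
    finally have "real (card {x \<in> F. restrict x S = a})
        \<le> real (\<Sum>v\<in>Nb. card {x \<in> F. restrict x (insert j S) = a(j := v)})"
      by (rule of_nat_mono)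
    also have "\<dots> = (\<Sum>v\<in>Nb. real (card {x \<in> F. restrict x (insert j S) = a(j := v)}))"
      by (rule of_nat_sum)
    also have "\<dots> \<le> (\<Sum>v\<in>Nb. D ^ k)"
    proof (rule sum_mono)
      fix v
      have "I - insert j S = (I - S) - {j}" by auto
      then have "k = card (I - insert j S)"
        using Suc.hyps(2) ij \<open>finite I\<close> by simp
      then show "real (card {x \<in> F. restrict x (insert j S) = a(j := v)}) \<le> D ^ k"
        using Suc.hyps(1)[of "insert j S" "a(j := v)"] Suc.prems ij by auto
    qed
    also have "\<dots> \<le> D * D ^ k" using Nb \<open>0 \<le> D\<close> by (simp add: mult_right_mono)
    finally show ?thesis using Suc.hyps(2) by (metis power_Suc)
  qed
qed

text \<open>The step \<open>s = 1\<close> gives pentagons and \<open>s = 2\<close> pentagrams.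
  Removing the vertices of large degree into another block costs at most half of each block; then
  \<open>cycle_sum_lower\<close> counts the surviving cycles and \<open>card_extensions_le\<close>
  with \<open>D = 2 * p * m\<close> bounds the extensions.\<close>

lemma cycle_family:
  fixes U :: "nat \<Rightarrow> 'a set" and m s :: nat
  assumes s: "s = 1 \<or> s = 2"
    and U: "\<And>i. i < 5 \<Longrightarrow> U i \<subseteq> V" "\<And>i. i < 5 \<Longrightarrow> card (U i) = m"
    and disj: "\<And>i j. i < 5 \<Longrightarrow> j < 5 \<Longrightarrow> i \<noteq> j \<Longrightarrow> U i \<inter> U j = {}"
    and m: "0 < m" and small: "\<alpha> \<le> p\<^sup>2 * m / 8"
  obtains F where "F \<subseteq> PiE {..<5} U"
    and "\<And>x i. x \<in> F \<Longrightarrow> i < 5 \<Longrightarrow> E (x i) (x ((i + s) mod 5))"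
    and "p ^ 5 * real m ^ 5 / 8192 \<le> card F"
    and "\<And>S a. S \<subseteq> {..<5} \<Longrightarrow> S \<noteq> {} \<Longrightarrow>
      real (card {x \<in> F. restrict x S = a}) \<le> (2 * p * m) ^ card ({..<5} - S)"
proof -
  define T where "T = (\<lambda>i. {v \<in> U i. \<forall>j<5. j \<noteq> i \<longrightarrow> deg v (U j) \<le> 2 * p * m})"
  define F where "F = {x \<in> PiE {..<5} T. \<forall>i<5. E (x i) (x ((i + s) mod 5))}"
  have TU: "T i \<subseteq> U i" for i by (auto simp: T_def)
  have finU: "finite (U i)" if "i < 5" for i using U(1)[OF that] finite_V finite_subset by blast
  then have finT: "finite (T i)" if "i < 5" for i using TU that finite_subset by blast
  have TV: "T i \<subseteq> V" if "i < 5" for i using TU U that by blast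
  have disjT: "T i \<inter> T j = {}" if "i < 5" "j < 5" "i \<noteq> j" for i j using TU disj that by blast
  have finPi: "finite (PiE {..<5} T)" using finT by (intro finite_PiE) auto
  then have finF: "finite F" by (simp add: F_def)
  have cT: "real m / 2 \<le> card (T i)" if i: "i < 5" for i
  proof -
    define B where "B = (\<lambda>j. {v \<in> U i. 2 * p * card (U j) < deg v (U j)})"
    \<comment> \<open>The bound \<open>m / 64\<close> comes from squaring
      \<open>\<alpha> <= p^2 * m / 8\<close>; the four other blocks together cost at most
      \<open>m / 16\<close>.\<close>
    have B: "real (card (B j)) \<le> m / 64" if j: "j \<in> {..<5} - {i}" for j
    proof -
      have "p\<^sup>2 * real (card (B j)) * m \<le> \<alpha>\<^sup>2"
        using few_high_degree[of "U i" "U j"] U disj i j by (auto simp: B_def)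
      also have "\<dots> \<le> (p\<^sup>2 * m / 8)\<^sup>2" using small alpha_nonneg by (intro power_mono) auto
      also have "\<dots> = p\<^sup>2 * (p\<^sup>2 * (m / 64)) * m" by (simp add: power2_eq_square)
      also have "\<dots> \<le> p\<^sup>2 * (1 * (m / 64)) * m"
        using p_pos p_le_1 by (intro mult_left_mono mult_right_mono) (auto simp: power_le_one)
      finally show ?thesis using p_pos m by simp
    qed
    have "U i \<subseteq> T i \<union> (\<Union>j\<in>{..<5} - {i}. B j)"
      using U(2) by (auto simp: T_def B_def not_le)
    then have "card (U i) \<le> card (T i \<union> (\<Union>j\<in>{..<5} - {i}. B j))"
      using finU finT i by (intro card_mono) (auto simp: B_def)
    also have "\<dots> \<le> card (T i) + card (\<Union>j\<in>{..<5} - {i}. B j)" by (rule card_Un_le)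
    also have "\<dots> \<le> card (T i) + (\<Sum>j\<in>{..<5} - {i}. card (B j))" by (intro add_mono card_UN_le) auto
    finally have "real m \<le> real (card (T i) + (\<Sum>j\<in>{..<5} - {i}. card (B j)))"
      unfolding U(2)[OF i] by (rule of_nat_mono)
    then have "real m \<le> real (card (T i)) + (\<Sum>j\<in>{..<5} - {i}. real (card (B j)))"
      unfolding of_nat_add of_nat_sum .
    also have "(\<Sum>j\<in>{..<5} - {i}. real (card (B j))) \<le> real (card ({..<5} - {i})) * (m / 64)"
      by (intro sum_bounded_above B)
    also have "card ({..<5} - {i}) = 4" using i by simp
    finally show ?thesis by simp
  qed
  have low: "p ^ 5 * real m ^ 5 / 8192 \<le> card F"
  proof -
    have "real (card F) = (\<Sum>x\<in>PiE {..<5} T. of_bool (\<forall>i<5. E (x i) (x ((i + s) mod 5))))"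
      using finPi by (simp add: F_def Int_def flip: of_bool_def)
    also have "p ^ 5 * real m ^ 5 / 8192 \<le> \<dots>"
      using s
    proof
      assume [simp]: "s = 1"
      have I: "{..<5::nat} = insert 0 (insert 1 (insert 2 (insert 3 (insert 4 {}))))" by auto
      have "p ^ 5 * real m ^ 5 / 8192 \<le>
        (\<Sum>x0\<in>T 0. \<Sum>x1\<in>T 1. \<Sum>x2\<in>T 2. \<Sum>x3\<in>T 3. \<Sum>x4\<in>T 4.
          of_bool (E x0 x1 \<and> E x1 x2 \<and> E x2 x3 \<and> E x3 x4 \<and> E x4 x0))"
        by (rule cycle_sum_lower) (use TV disjT cT m small in auto)
      then show ?thesis
        unfolding I by (simp add: sum_PiE_insert all_less_5 conj_ac del: One_nat_def)
    next
      assume [simp]: "s = 2"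
      \<comment> \<open>In steps of 2 the cycle visits the indices in the order 0, 2, 4, 1, 3; this
        order makes the iterated sum match \<open>cycle_sum_lower\<close>.\<close>
      have I: "{..<5::nat} = insert 0 (insert 2 (insert 4 (insert 1 (insert 3 {}))))" by auto
      have "p ^ 5 * real m ^ 5 / 8192 \<le>
        (\<Sum>x0\<in>T 0. \<Sum>x1\<in>T 2. \<Sum>x2\<in>T 4. \<Sum>x3\<in>T 1. \<Sum>x4\<in>T 3.
          of_bool (E x0 x1 \<and> E x1 x2 \<and> E x2 x3 \<and> E x3 x4 \<and> E x4 x0))"
        by (rule cycle_sum_lower) (use TV disjT cT m small in auto)
      then show ?thesis
        unfolding I by (simp add: sum_PiE_insert all_less_5 conj_ac del: One_nat_def)
    qed
    finally show ?thesis .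
  qed
  show thesis
  proof
    show "F \<subseteq> PiE {..<5} U" unfolding F_def by (rule order_trans[OF Collect_subset PiE_mono[OF TU]])
    show "E (x i) (x ((i + s) mod 5))" if "x \<in> F" "i < 5" for x i
      using that by (simp add: F_def)
    show "p ^ 5 * real m ^ 5 / 8192 \<le> card F" by (rule low)
    show "real (card {x \<in> F. restrict x S = a}) \<le> (2 * p * m) ^ card ({..<5} - S)"
      if S: "S \<subseteq> {..<5}" "S \<noteq> {}" for S a
    proof (rule card_extensions_le[where T = T and R = "\<lambda>i j. j = (i + s) mod 5"])
      fix S' :: "nat set" assume S': "S' \<subseteq> {..<5}" "S' \<noteq> {}" "S' \<noteq> {..<5}"
      show "\<exists>i\<in>S'. \<exists>j\<in>{..<5} - S'. j = (i + s) mod 5"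
      proof (rule ccontr)
        assume "\<not> ?thesis"
        then have "\<And>i. i \<in> S' \<Longrightarrow> (i + s) mod 5 \<in> S'" by auto
        then show False using eq_lessThan_5_if_closed[OF S'(1,2) _ s] S'(3) by blast
      qed
    next
      fix v i j assume "i \<in> {..<5::nat}" "j \<in> {..<5::nat}" "i \<noteq> j" "v \<in> T i"
      then show "deg v (T j) \<le> 2 * p * m"
        using deg_mono[OF TU[of j] finU, of v] by (auto simp: T_def intro: order_trans)
    next
      show "F \<subseteq> PiE {..<5} T" unfolding F_def by (rule Collect_subset)
    next
      fix x i j assume "x \<in> F" "i \<in> {..<5::nat}" "j = (i + s) mod 5"
      then show "E (x i) (x j)" by (simp add: F_def)
    next
      show "0 \<le> 2 * p * real m" using p_pos by simp
    qed (use S finF finT in simp_all)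
  qed
qed

end

section \<open>Linking two pentagons by a perfect matching\<close>

context pseudorandom
begin

text \<open>If no pair is linked, the expanded sum vanishes, so the term for \<open>S = {}\<close>
  is at most the sum of the absolute values of the others. That term is
  \<open>p ^ card I * card F * card G\<close>, whereas the bounds on the others contain only the
  square root of \<open>card F * card G\<close>; cancelling this root contradicts
  \<open>large\<close>.\<close>

lemma exists_linked_pair:
  fixes U W :: "'i \<Rightarrow> 'a set"
  assumes I: "finite I"
    and UW: "\<And>i. i \<in> I \<Longrightarrow> U i \<subseteq> V \<and> W i \<subseteq> V \<and> U i \<inter> W i = {}"
    and card: "\<And>i. i \<in> I \<Longrightarrow> card (U i) \<le> N \<and> card (W i) \<le> N"
    and FG: "F \<subseteq> PiE I U" "G \<subseteq> PiE I W"
    and F: "\<And>S a. S \<subseteq> I \<Longrightarrow> S \<noteq> {} \<Longrightarrow> real (card {x \<in> F. restrict x S = a}) \<le> D ^ card (I - S)"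
    and G: "\<And>S a. S \<subseteq> I \<Longrightarrow> S \<noteq> {} \<Longrightarrow> real (card {y \<in> G. restrict y S = a}) \<le> D ^ card (I - S)"
    and D: "0 \<le> D"
    and large: "(\<Sum>S\<in>Pow I - {{}}. p ^ card (I - S) * (2 * harm N * \<alpha>) ^ card S * D ^ card (I - S))
      < p ^ card I * sqrt (real (card F) * real (card G))"
  shows "\<exists>x\<in>F. \<exists>y\<in>G. \<forall>i\<in>I. E (x i) (y i)"
proof (rule ccontr)
  assume contra: "\<not> ?thesis"
  define L where "L = 2 * harm N * \<alpha>"
  have "0 \<le> L" unfolding L_def using alpha_nonneg by (simp add: harm_nonneg)
  define M :: "'a \<Rightarrow> 'a \<Rightarrow> real" where "M = (\<lambda>u w. of_bool (E u w) - p)"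
  have finUW: "finite (U i)" "finite (W i)" if "i \<in> I" for i
    using UW[OF that] finite_V finite_subset by blast+
  have finPi: "finite (PiE S U)" "finite (PiE S W)" if "S \<subseteq> I" for S
    using finUW that finite_subset[OF that I] by (auto intro!: finite_PiE)
  have fin: "finite F" "finite G" using FG finPi[of I] finite_subset by auto
  have opn: "(\<Sum>w\<in>W i. (\<Sum>x\<in>U i. u x * M x w)\<^sup>2) \<le> L\<^sup>2 * (\<Sum>x\<in>U i. (u x)\<^sup>2)" if i: "i \<in> I" for i u
    unfolding L_def
  proof (rule operator_norm_le)
    fix X Y assume XY: "X \<subseteq> U i" "Y \<subseteq> W i"
    then have "X \<subseteq> V" "Y \<subseteq> V" "X \<inter> Y = {}" using UW[OF i] by auto
    moreover have "(\<Sum>x\<in>X. \<Sum>y\<in>Y. M x y) = (\<Sum>x\<in>X. \<Sum>y\<in>Y. of_bool (E x y)) - p * real (card X) * real (card Y)"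
      by (simp add: M_def sum_subtractf mult_ac)
    ultimately show "\<bar>\<Sum>x\<in>X. \<Sum>y\<in>Y. M x y\<bar> \<le> \<alpha> * sqrt (real (card X) * real (card Y))"
      using disc by metis
  qed (use finUW card i in auto)
  define T where "T = (\<lambda>S. \<Sum>x\<in>F. \<Sum>y\<in>G. \<Prod>i\<in>S. M (x i) (y i))"
  have T_bound: "\<bar>T S\<bar> \<le> L ^ card S * D ^ card (I - S) * sqrt (real (card F) * real (card G))"
    if S: "S \<subseteq> I" "S \<noteq> {}" for S
  proof -
    \<comment> \<open>The extension counts \<open>f\<close> and \<open>g\<close>, as vectors indexed
      by assignments on \<open>S\<close>, turn \<open>T S\<close> into a bilinear form of the tensor
      power of \<open>M\<close>.\<close>
    define f where "f = (\<lambda>a. real (card {x \<in> F. restrict x S = a}))"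
    define g where "g = (\<lambda>a. real (card {y \<in> G. restrict y S = a}))"
    have resF: "(\<lambda>x. restrict x S) ` F \<subseteq> PiE S U" and resG: "(\<lambda>y. restrict y S) ` G \<subseteq> PiE S W"
    proof -
      have res: "restrict z S \<in> PiE S Z" if "z \<in> PiE I Z" for z and Z :: "'i \<Rightarrow> 'a set"
        using that S(1) by (auto simp: PiE_iff)
      show "(\<lambda>x. restrict x S) ` F \<subseteq> PiE S U" "(\<lambda>y. restrict y S) ` G \<subseteq> PiE S W"
        by (rule image_subsetI, rule res, erule subsetD[OF FG(1)],
            rule image_subsetI, rule res, erule subsetD[OF FG(2)])
    qed
    have groupF: "(\<Sum>a\<in>PiE S U. f a * h a) = (\<Sum>x\<in>F. h (restrict x S))" for h :: "_ \<Rightarrow> real"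
      using sum.group[OF fin(1) finPi(1)[OF S(1)] resF, of "\<lambda>x. h (restrict x S)"] by (simp add: f_def)
    have groupG: "(\<Sum>a\<in>PiE S W. g a * h a) = (\<Sum>x\<in>G. h (restrict x S))" for h :: "_ \<Rightarrow> real"
      using sum.group[OF fin(2) finPi(2)[OF S(1)] resG, of "\<lambda>x. h (restrict x S)"] by (simp add: g_def)
    \<comment> \<open>Largest value times total: \<open>f\<close> is at most
      \<open>D ^ card (I - S)\<close> pointwise and sums to \<open>card F\<close>.\<close>
    have f2: "(\<Sum>a\<in>PiE S U. (f a)\<^sup>2) \<le> D ^ card (I - S) * card F"
    proof -
      have "(\<Sum>a\<in>PiE S U. (f a)\<^sup>2) \<le> (\<Sum>a\<in>PiE S U. f a * D ^ card (I - S))"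
        unfolding power2_eq_square using F[OF S] by (intro sum_mono mult_left_mono) (auto simp: f_def)
      then show ?thesis by (simp add: groupF mult.commute)
    qed
    have g2: "(\<Sum>a\<in>PiE S W. (g a)\<^sup>2) \<le> D ^ card (I - S) * card G"
    proof -
      have "(\<Sum>a\<in>PiE S W. (g a)\<^sup>2) \<le> (\<Sum>a\<in>PiE S W. g a * D ^ card (I - S))"
        unfolding power2_eq_square using G[OF S] by (intro sum_mono mult_left_mono) (auto simp: g_def)
      then show ?thesis by (simp add: groupG mult.commute)
    qed
    define h where "h = (\<lambda>b. \<Sum>a\<in>PiE S U. f a * (\<Prod>i\<in>S. M (a i) (b i)))"
    have "T S = (\<Sum>x\<in>F. \<Sum>y\<in>G. \<Prod>i\<in>S. M (restrict x S i) (restrict y S i))"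
      unfolding T_def by (intro sum.cong prod.cong refl) auto
    also have "\<dots> = (\<Sum>y\<in>G. h (restrict y S))"
      unfolding h_def groupF by (rule sum.swap)
    also have "\<dots> = (\<Sum>b\<in>PiE S W. g b * h b)" by (simp add: groupG)
    finally have "\<bar>T S\<bar> \<le> (\<Sum>b\<in>PiE S W. \<bar>g b\<bar> * \<bar>h b\<bar>)"
      by (simp add: order_trans[OF sum_abs] abs_mult)
    also have "\<dots> \<le> L2_set g (PiE S W) * L2_set h (PiE S W)" by (rule L2_set_mult_ineq)
    also have "\<dots> \<le> sqrt (D ^ card (I - S) * card G) * sqrt (L ^ (2 * card S) * (D ^ card (I - S) * card F))"
    proof (intro mult_mono)
      show "L2_set g (PiE S W) \<le> sqrt (D ^ card (I - S) * card G)"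
        unfolding L2_set_def using g2 by simp
      have "(\<Sum>b\<in>PiE S W. (h b)\<^sup>2) \<le> L ^ (2 * card S) * (\<Sum>a\<in>PiE S U. (f a)\<^sup>2)"
        unfolding h_def using S finUW opn finite_subset[OF S(1) I] by (intro tensor_norm_le) auto
      also have "\<dots> \<le> L ^ (2 * card S) * (D ^ card (I - S) * card F)"
        using f2 by (intro mult_left_mono) auto
      finally show "L2_set h (PiE S W) \<le> sqrt (L ^ (2 * card S) * (D ^ card (I - S) * card F))"
        unfolding L2_set_def by simp
    qed (use D in \<open>auto simp: L2_set_nonneg\<close>)
    also have "\<dots> = L ^ card S * D ^ card (I - S) * sqrt (real (card F) * real (card G))"
    proof -
      have "sqrt (L ^ (2 * card S)) = L ^ card S"
        unfolding power_even_eq using \<open>0 \<le> L\<close> by simp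
      moreover have "sqrt (D ^ card (I - S)) * sqrt (D ^ card (I - S)) = D ^ card (I - S)"
        using D by simp
      ultimately show ?thesis by (simp only: real_sqrt_mult mult_ac)
    qed
    finally show ?thesis .
  qed
  have expand: "0 = (\<Sum>S\<in>Pow I. p ^ card (I - S) * T S)"
  proof -
    have "0 = (\<Sum>x\<in>F. \<Sum>y\<in>G. \<Prod>i\<in>I. (of_bool (E (x i) (y i)) :: real))"
    proof -
      have "(\<Prod>i\<in>I. (of_bool (E (x i) (y i)) :: real)) = 0" if "x \<in> F" "y \<in> G" for x y
        using contra that by (intro prod_zero I) auto
      then show ?thesis by simp
    qed
    also have "\<dots> = (\<Sum>x\<in>F. \<Sum>y\<in>G. \<Prod>i\<in>I. M (x i) (y i) + p)"
      by (simp add: M_def)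
    also have "\<dots> = (\<Sum>x\<in>F. \<Sum>y\<in>G. \<Sum>S\<in>Pow I. p ^ card (I - S) * (\<Prod>i\<in>S. M (x i) (y i)))"
      using I by (simp add: prod_add mult.commute)
    also have "\<dots> = (\<Sum>x\<in>F. \<Sum>S\<in>Pow I. p ^ card (I - S) * (\<Sum>y\<in>G. \<Prod>i\<in>S. M (x i) (y i)))"
      by (subst sum.swap) (simp only: sum_distrib_left)
    also have "\<dots> = (\<Sum>S\<in>Pow I. p ^ card (I - S) * T S)"
      unfolding T_def by (subst sum.swap) (simp only: sum_distrib_left)
    finally show ?thesis .
  qed
  note expand
  also have "(\<Sum>S\<in>Pow I. p ^ card (I - S) * T S)
      = p ^ card I * T {} + (\<Sum>S\<in>Pow I - {{}}. p ^ card (I - S) * T S)"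
    using I by (subst sum.remove[of _ "{}"]) auto
  also have "T {} = real (card F) * real (card G)" by (simp add: T_def)
  finally have "p ^ card I * (real (card F) * real (card G))
      = - (\<Sum>S\<in>Pow I - {{}}. p ^ card (I - S) * T S)"
    unfolding eq_neg_iff_add_eq_0 by (rule sym)
  also have "\<dots> \<le> (\<Sum>S\<in>Pow I - {{}}. p ^ card (I - S) * \<bar>T S\<bar>)"
    unfolding sum_negf[symmetric] using p_pos
    by (intro sum_mono, subst minus_mult_right, intro mult_left_mono) auto
  also have "\<dots> \<le> (\<Sum>S\<in>Pow I - {{}}. p ^ card (I - S) *
      (L ^ card S * D ^ card (I - S) * sqrt (real (card F) * real (card G))))"
    using T_bound p_pos by (intro sum_mono mult_left_mono) auto
  also have "\<dots> = (\<Sum>S\<in>Pow I - {{}}. p ^ card (I - S) * L ^ card S * D ^ card (I - S))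
      * sqrt (real (card F) * real (card G))"
    by (simp add: sum_distrib_right mult.assoc)
  finally have le: "p ^ card I * (real (card F) * real (card G)) \<le> \<dots>" .
  define q where "q = sqrt (real (card F) * real (card G))"
  have q: "real (card F) * real (card G) = q * q" "0 \<le> q" by (simp_all add: q_def)
  have nonneg: "0 \<le> (\<Sum>S\<in>Pow I - {{}}. p ^ card (I - S) * L ^ card S * D ^ card (I - S))"
    using p_pos D \<open>0 \<le> L\<close> by (intro sum_nonneg) auto
  have large': "(\<Sum>S\<in>Pow I - {{}}. p ^ card (I - S) * L ^ card S * D ^ card (I - S)) < p ^ card I * q"
    using large unfolding L_def q_def .
  \<comment> \<open>The left side of \<open>large'\<close> is nonnegative, so its strictness
    excludes \<open>q = 0\<close> and the root can be cancelled.\<close>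
  have "q \<noteq> 0" using large' nonneg by auto
  then have "0 < q" using q(2) by simp
  have "(p ^ card I * q) * q \<le> (\<Sum>S\<in>Pow I - {{}}. p ^ card (I - S) * L ^ card S * D ^ card (I - S)) * q"
    using le unfolding q_def[symmetric] unfolding q(1) mult.assoc .
  then have "p ^ card I * q \<le> (\<Sum>S\<in>Pow I - {{}}. p ^ card (I - S) * L ^ card S * D ^ card (I - S))"
    by (rule mult_right_le_imp_le) (rule \<open>0 < q\<close>)
  then show False using large' by linarith
qed

text \<open>The first five blocks carry the pentagon and the last five the pentagram. The main term
  is at least \<open>p^10 * m^5 / 2^13\<close>; the 31 nonempty sets contribute at most
  \<open>p^10 * m^5 / 2^18\<close> each, and 31 is less than \<open>2^5\<close>.\<close>

lemma petersen_pattern: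
  fixes U :: "nat \<Rightarrow> 'a set" and m :: nat
  assumes U: "\<And>i. i < 10 \<Longrightarrow> U i \<subseteq> V" "\<And>i. i < 10 \<Longrightarrow> card (U i) = m"
    and disj: "\<And>i j. i < 10 \<Longrightarrow> j < 10 \<Longrightarrow> i \<noteq> j \<Longrightarrow> U i \<inter> U j = {}"
    and m: "0 < m" and small: "2 * harm m * \<alpha> \<le> p\<^sup>2 * m / 2 ^ 22"
  obtains x y where "\<And>i. i < 5 \<Longrightarrow> x i \<in> U i" "\<And>i. i < 5 \<Longrightarrow> y i \<in> U (i + 5)"
    "\<And>i. i < 5 \<Longrightarrow> E (x i) (x ((i + 1) mod 5))"
    "\<And>i. i < 5 \<Longrightarrow> E (y i) (y ((i + 2) mod 5))"
    "\<And>i. i < 5 \<Longrightarrow> E (x i) (y i)"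
proof -
  define W where "W = (\<lambda>i. U (i + 5))"
  \<comment> \<open>Since \<open>harm m\<close> is at least 1, the hypothesis also bounds
    \<open>\<alpha>\<close> itself, as \<open>cycle_family\<close> requires.\<close>
  have "harm 1 \<le> (harm m :: real)" using m by (intro harm_mono) auto
  then have "1 * \<alpha> \<le> harm m * \<alpha>"
    using alpha_nonneg by (intro mult_right_mono) (auto simp: harm_def)
  moreover have small2: "8388608 * (harm m * \<alpha>) \<le> p\<^sup>2 * real m" using small by simp
  moreover have "0 \<le> p\<^sup>2 * real m" by simp
  ultimately have \<alpha>: "\<alpha> \<le> p\<^sup>2 * m / 8" using small2 by linarith
  have W: "\<And>i. i < 5 \<Longrightarrow> W i \<subseteq> V" "\<And>i. i < 5 \<Longrightarrow> card (W i) = m"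
    "\<And>i j. i < 5 \<Longrightarrow> j < 5 \<Longrightarrow> i \<noteq> j \<Longrightarrow> W i \<inter> W j = {}"
    using U disj by (auto simp: W_def)
  obtain F where F: "F \<subseteq> PiE {..<5} U"
    "\<And>x i. x \<in> F \<Longrightarrow> i < 5 \<Longrightarrow> E (x i) (x ((i + 1) mod 5))"
    "p ^ 5 * real m ^ 5 / 8192 \<le> card F"
    "\<And>S a. S \<subseteq> {..<5} \<Longrightarrow> S \<noteq> {} \<Longrightarrow>
      real (card {x \<in> F. restrict x S = a}) \<le> (2 * p * m) ^ card ({..<5} - S)"
    by (rule cycle_family[of 1 U m]) (use U disj m \<alpha> in auto)
  obtain G where G: "G \<subseteq> PiE {..<5} W"
    "\<And>x i. x \<in> G \<Longrightarrow> i < 5 \<Longrightarrow> E (x i) (x ((i + 2) mod 5))"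
    "p ^ 5 * real m ^ 5 / 8192 \<le> card G"
    "\<And>S a. S \<subseteq> {..<5} \<Longrightarrow> S \<noteq> {} \<Longrightarrow>
      real (card {x \<in> G. restrict x S = a}) \<le> (2 * p * m) ^ card ({..<5} - S)"
    by (rule cycle_family[of 2 W m]) (use W m \<alpha> in auto)
  have "\<exists>x\<in>F. \<exists>y\<in>G. \<forall>i\<in>{..<5}. E (x i) (y i)"
  proof (rule exists_linked_pair[where D = "2 * p * m" and U = U and W = W and N = m])
    let ?t = "\<lambda>S. p ^ card ({..<5} - S) * (2 * harm m * \<alpha>) ^ card S * (2 * p * m) ^ card ({..<5} - S)"
    \<comment> \<open>With \<open>k = card S\<close> the bound is
      \<open>p^10 * m^5 * 2^(5 - 23 * k)\<close>, largest at \<open>k = 1\<close>.\<close>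
    have term_le: "?t S \<le> p ^ 10 * real m ^ 5 / 2 ^ 18" if S: "S \<in> Pow {..<5::nat} - {{}}" for S
    proof -
      have "S \<subseteq> {..<5}" "S \<noteq> {}" using S by auto
      then have "finite S" "card S \<le> 5" using finite_subset card_mono[of "{..<5}" S] by auto
      then have k: "1 \<le> card S" "card S \<le> 5" "card ({..<5} - S) = 5 - card S"
        using \<open>S \<noteq> {}\<close> \<open>S \<subseteq> {..<5}\<close> by (auto simp: card_Diff_subset Suc_le_eq card_gt_0_iff)
      have "?t S \<le> p ^ (5 - card S) * (p\<^sup>2 * m / 2 ^ 22) ^ card S * (2 * p * m) ^ (5 - card S)"
        unfolding k(3) using small alpha_nonneg p_pos
        by (intro mult_right_mono mult_left_mono power_mono) (auto simp: harm_nonneg)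
      also have "\<dots> \<le> p ^ 10 * real m ^ 5 / 2 ^ 18"
      proof -
        have "card S \<in> {1, 2, 3, 4, 5}" using k by auto
        moreover have "0 \<le> p ^ 10 * real m ^ 5" using p_pos by simp
        ultimately show ?thesis
          by (auto simp: power_mult_distrib power_divide field_simps eval_nat_numeral)
      qed
      finally show ?thesis .
    qed
    have "(\<Sum>S\<in>Pow {..<5::nat} - {{}}. ?t S) \<le> real (card (Pow {..<5::nat} - {{}})) * (p ^ 10 * real m ^ 5 / 2 ^ 18)"
      by (intro sum_bounded_above term_le)
    also have "card (Pow {..<5::nat} - {{}}) = 31" by (simp add: card_Pow)
    also have "real 31 * (p ^ 10 * real m ^ 5 / 2 ^ 18) < p ^ 5 * (p ^ 5 * real m ^ 5 / 8192)"
      using p_pos m by (simp add: field_simps eval_nat_numeral)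
    also have "p ^ 5 * real m ^ 5 / 8192 \<le> sqrt (real (card F) * real (card G))"
    proof -
      have "sqrt ((p ^ 5 * real m ^ 5 / 8192) * (p ^ 5 * real m ^ 5 / 8192)) \<le> sqrt (real (card F) * real (card G))"
        using F(3) G(3) p_pos by (intro real_sqrt_le_mono mult_mono) auto
      moreover have "0 \<le> p ^ 5 * real m ^ 5 / 8192" using p_pos by simp
      ultimately show ?thesis unfolding real_sqrt_abs2 by simp
    qed
    finally show "(\<Sum>S\<in>Pow {..<5::nat} - {{}}. ?t S) < p ^ card {..<5::nat} * sqrt (real (card F) * real (card G))"
      using p_pos by simp
  qed (use U W disj F G p_pos in \<open>auto simp: W_def\<close>)
  then obtain x y where xy: "x \<in> F" "y \<in> G" "\<And>i. i < 5 \<Longrightarrow> E (x i) (y i)" by auto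
  show thesis
  proof (rule that[of x y])
    show "x i \<in> U i" if "i < 5" for i using PiE_mem[OF subsetD[OF F(1) xy(1)]] that by simp
    show "y i \<in> U (i + 5)" if "i < 5" for i
      using PiE_mem[OF subsetD[OF G(1) xy(2)]] that by (simp add: W_def)
    show "E (x i) (x ((i + 1) mod 5))" if "i < 5" for i by (rule F(2)[OF xy(1) that])
    show "E (y i) (y ((i + 2) mod 5))" if "i < 5" for i by (rule G(2)[OF xy(2) that])
    show "E (x i) (y i)" if "i < 5" for i by (rule xy(3)[OF that])
  qed
qed

end

section \<open>The Petersen graph\<close>

text \<open>Disjointness excludes edges inside the intersection and makes the pair
  \<open>(x, y)\<close> recoverable from \<open>{x, y}\<close>.\<close>

lemma edges_between_disjoint:
  assumes "simple_graph G" "X \<subseteq> verts G" "Y \<subseteq> verts G" "X \<inter> Y = {}"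
  shows "real (edges_between G X Y) = (\<Sum>x\<in>X. \<Sum>y\<in>Y. of_bool ({x, y} \<in> edges G))"
proof -
  have fin: "finite X" "finite Y"
    using assms finite_subset unfolding simple_graph_def by blast+
  define P where "P = {z \<in> X \<times> Y. {fst z, snd z} \<in> edges G}"
  have loop: "{e \<in> edges G. e \<subseteq> X \<inter> Y} = {}"
    using assms(1,4) by (auto simp: simple_graph_def)
  have "inj_on (\<lambda>z. {fst z, snd z}) P"
    using assms(4) by (auto simp: inj_on_def P_def doubleton_eq_iff)
  moreover have "{e \<in> edges G. \<exists>x\<in>X. \<exists>y\<in>Y. e = {x, y}} = (\<lambda>z. {fst z, snd z}) ` P"
    unfolding P_def image_def by (auto; force)
  ultimately have "edges_between G X Y = card P"
    unfolding edges_between_def loop by (simp add: card_image)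
  also have "real (card P) = (\<Sum>z\<in>X \<times> Y. of_bool ({fst z, snd z} \<in> edges G))"
    using fin by (simp add: P_def Int_def flip: of_bool_def)
  also have "\<dots> = (\<Sum>x\<in>X. \<Sum>y\<in>Y. of_bool ({x, y} \<in> edges G))"
    by (simp add: sum.cartesian_product case_prod_unfold)
  finally show ?thesis .
qed

lemma pseudorandom_if_jumbled:
  assumes "simple_graph G" "jumbled G p \<alpha>" "0 < p" "p \<le> 1" "0 \<le> \<alpha>"
  shows "pseudorandom (\<lambda>x y. {x, y} \<in> edges G) (verts G) p \<alpha>"
proof
  show "finite (verts G)" using assms(1) by (simp add: simple_graph_def)
  show "{y, x} \<in> edges G" if "{x, y} \<in> edges G" for x y
    using that by (simp add: insert_commute)
  fix X Y assume XY: "X \<subseteq> verts G" "Y \<subseteq> verts G" "X \<inter> Y = {}"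
  then show "\<bar>(\<Sum>x\<in>X. \<Sum>y\<in>Y. of_bool ({x, y} \<in> edges G)) - p * real (card X) * real (card Y)\<bar>
      \<le> \<alpha> * sqrt (real (card X) * real (card Y))"
    using assms(2) unfolding jumbled_def edges_between_disjoint[OF assms(1) XY, symmetric] by blast
qed (use assms in auto)

text \<open>The blocks are the images of consecutive intervals of length \<open>m\<close> under an
  enumeration of \<open>V\<close>.\<close>

lemma disjoint_blocks:
  assumes "finite V" "k * m \<le> card V"
  obtains U :: "nat \<Rightarrow> 'a set" where "\<And>i. i < k \<Longrightarrow> U i \<subseteq> V" "\<And>i. i < k \<Longrightarrow> card (U i) = m"
    "\<And>i j. i < k \<Longrightarrow> j < k \<Longrightarrow> i \<noteq> j \<Longrightarrow> U i \<inter> U j = {}"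
proof -
  obtain h where h: "bij_betw h {0..<card V} V"
    using ex_bij_betw_nat_finite[OF assms(1)] by blast
  define J where "J = (\<lambda>i. {i * m..<Suc i * m})"
  have J: "J i \<subseteq> {0..<card V}" if "i < k" for i
  proof -
    have "Suc i * m \<le> k * m" using that by (intro mult_le_mono1) simp
    then have "Suc i * m \<le> card V" using assms(2) by (rule order_trans)
    then show ?thesis unfolding J_def by (auto dest: less_le_trans)
  qed
  have below: "J i \<inter> J j = {}" if "i < j" for i j
  proof -
    have "Suc i * m \<le> j * m" using that by (intro mult_le_mono1) simp
    then show ?thesis unfolding J_def by fastforce
  qed
  have inj: "inj_on h {0..<card V}" using h by (rule bij_betw_imp_inj_on)
  show thesis
  proof (rule that[of "\<lambda>i. h ` J i"])
    show "h ` J i \<subseteq> V" if "i < k" for i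
      using J[OF that] h unfolding bij_betw_def by blast
    show "card (h ` J i) = m" if "i < k" for i
      using card_image[OF inj_on_subset[OF inj J[OF that]]] by (simp add: J_def)
    show "h ` J i \<inter> h ` J j = {}" if "i < k" "j < k" "i \<noteq> j" for i j
    proof -
      have "J i \<inter> J j = {}" using below[of i j] below[of j i] that(3) by (cases "i < j") auto
      then show ?thesis
        using inj_on_image_Int[OF inj J[OF that(1)] J[OF that(2)]] by simp
    qed
  qed
qed

text \<open>Labels 0 to 4 form a pentagon, 5 to 9 a pentagram, and \<open>i\<close> is matched to \<open>i + 5\<close>.\<close>
definition petersen_label :: "nat \<Rightarrow> nat set" where
  "petersen_label i = [{1, 2}, {3, 4}, {1, 5}, {2, 3}, {4, 5}, {3, 5}, {2, 5}, {2, 4}, {1, 4}, {1, 3}] ! i"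

lemma petersen_label_simps:
  "petersen_label 0 = {1, 2}" "petersen_label 1 = {3, 4}" "petersen_label 2 = {1, 5}"
  "petersen_label 3 = {2, 3}" "petersen_label 4 = {4, 5}" "petersen_label 5 = {3, 5}"
  "petersen_label 6 = {2, 5}" "petersen_label 7 = {2, 4}" "petersen_label 8 = {1, 4}"
  "petersen_label 9 = {1, 3}"
  by (simp_all add: petersen_label_def)

lemma lessThan_10: "{..<10::nat} = {0, 1, 2, 3, 4, 5, 6, 7, 8, 9}"
  by auto

lemma inj_on_petersen_label: "inj_on petersen_label {..<10}"
  unfolding lessThan_10 by (simp add: petersen_label_simps doubleton_eq_iff del: One_nat_def)

lemma verts_petersen: "verts petersen = petersen_label ` {..<10}"
proof -
  have "A \<in> petersen_label ` {..<10}" if A: "A \<subseteq> {1..5}" "card A = 2" for A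
  proof -
    obtain a b where ab: "A = {a, b}" "a \<noteq> b" using A(2) by (auto simp: card_2_iff)
    then have "a \<in> {1, 2, 3, 4, 5}" "b \<in> {1, 2, 3, 4, 5}" using A(1) by auto
    then show ?thesis
      using ab(2) unfolding lessThan_10 ab(1)
      by (auto simp: petersen_label_simps doubleton_eq_iff simp del: One_nat_def)
  qed
  moreover have "petersen_label i \<subseteq> {1..5} \<and> card (petersen_label i) = 2" if "i < 10" for i
  proof -
    have "i \<in> {0, 1, 2, 3, 4, 5, 6, 7, 8, 9}" using that unfolding lessThan_10[symmetric] by simp
    then show ?thesis by (auto simp: petersen_label_simps simp del: One_nat_def)
  qed
  ultimately show ?thesis by (auto simp: petersen_def)
qed

text \<open>The embedding inverts the labelling and then applies \<open>z\<close>.\<close>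

lemma contains_petersen:
  fixes z :: "nat \<Rightarrow> 'a"
  assumes inj: "inj_on z {..<10}" and z: "\<And>i. i < 10 \<Longrightarrow> z i \<in> verts G"
    and outer: "\<And>i. i < 5 \<Longrightarrow> {z i, z ((i + 1) mod 5)} \<in> edges G"
    and inner: "\<And>i. i < 5 \<Longrightarrow> {z (i + 5), z ((i + 2) mod 5 + 5)} \<in> edges G"
    and spoke: "\<And>i. i < 5 \<Longrightarrow> {z i, z (i + 5)} \<in> edges G"
  shows "contains_subgraph G petersen"
proof -
  define f where "f = z \<circ> inv_into {..<10} petersen_label"
  have f: "f (petersen_label i) = z i" if "i < 10" for i
    using inj_on_petersen_label that by (simp add: f_def)
  have "inj_on f (verts petersen)"
    unfolding verts_petersen
    using inj f inj_on_petersen_label by (auto simp: inj_on_def)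
  moreover have "f ` verts petersen \<subseteq> verts G"
    unfolding verts_petersen using f z by auto
  moreover have "f ` e \<in> edges G" if "e \<in> edges petersen" for e
  proof -
    from that have "\<exists>A B. e = {A, B} \<and> A \<subseteq> {1..5} \<and> card A = 2 \<and> B \<subseteq> {1..5} \<and> card B = 2 \<and> A \<inter> B = {}"
      by (simp add: petersen_def)
    then obtain A B where e: "e = {A, B}" and A: "A \<subseteq> {1..5}" "card A = 2"
      and B: "B \<subseteq> {1..5}" "card B = 2" and AB: "A \<inter> B = {}"
      by (elim exE conjE)
    have "A \<in> verts petersen" "B \<in> verts petersen" using A B by (simp_all add: petersen_def)
    then obtain i j where ij: "i < 10" "j < 10" "A = petersen_label i" "B = petersen_label j"
      unfolding verts_petersen by auto
    have edge_sym: "{a, b} \<in> edges G \<Longrightarrow> {b, a} \<in> edges G" for a b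
      by (simp add: insert_commute)
    have edge: "{z 0, z 1} \<in> edges G" "{z 1, z 2} \<in> edges G" "{z 2, z 3} \<in> edges G"
      "{z 3, z 4} \<in> edges G" "{z 4, z 0} \<in> edges G"
      "{z 5, z 7} \<in> edges G" "{z 6, z 8} \<in> edges G" "{z 7, z 9} \<in> edges G"
      "{z 8, z 5} \<in> edges G" "{z 9, z 6} \<in> edges G"
      "{z 0, z 5} \<in> edges G" "{z 1, z 6} \<in> edges G" "{z 2, z 7} \<in> edges G"
      "{z 3, z 8} \<in> edges G" "{z 4, z 9} \<in> edges G"
      using outer[of 0] outer[of 1] outer[of 2] outer[of 3] outer[of 4]
        inner[of 0] inner[of 1] inner[of 2] inner[of 3] inner[of 4]
        spoke[of 0] spoke[of 1] spoke[of 2] spoke[of 3] spoke[of 4]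
      by (simp_all add: numeral_2_eq_2[symmetric])
    have "i \<in> {0, 1, 2, 3, 4, 5, 6, 7, 8, 9}" "j \<in> {0, 1, 2, 3, 4, 5, 6, 7, 8, 9}"
      using ij(1,2) unfolding lessThan_10[symmetric] by simp_all
    \<comment> \<open>Inspection of all hundred pairs of labels: intersecting labels contradict
      \<open>AB\<close>, and disjoint ones give one of the fifteen listed edges in either
      order.\<close>
    then have "{z i, z j} \<in> edges G"
      using AB unfolding ij(3,4)
      by (elim insertE emptyE)
        (simp_all add: petersen_label_simps edge edge[THEN edge_sym] del: One_nat_def)
    then show ?thesis using f ij by (simp add: e)
  qed
  ultimately show ?thesis unfolding contains_subgraph_def by blast
qed

text \<open>The pattern does not say that its ten vertices are distinct; this follows because they
  lie in pairwise disjoint blocks.\<close>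

lemma contains_petersen_if_jumbled:
  fixes G :: "'a ugraph"
  assumes G: "simple_graph G" "jumbled G p \<alpha>" and p: "0 < p" "p \<le> 1" "0 \<le> \<alpha>"
    and m: "0 < m" "10 * m \<le> card (verts G)" and small: "2 * harm m * \<alpha> \<le> p\<^sup>2 * m / 2 ^ 22"
  shows "contains_subgraph G petersen"
proof -
  interpret pseudorandom "\<lambda>x y. {x, y} \<in> edges G" "verts G" p \<alpha>
    using pseudorandom_if_jumbled[OF G p] .
  obtain U :: "nat \<Rightarrow> 'a set" where U: "\<And>i. i < 10 \<Longrightarrow> U i \<subseteq> verts G" "\<And>i. i < 10 \<Longrightarrow> card (U i) = m"
    "\<And>i j. i < 10 \<Longrightarrow> j < 10 \<Longrightarrow> i \<noteq> j \<Longrightarrow> U i \<inter> U j = {}"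
    by (rule disjoint_blocks[OF finite_V m(2)]) (rule that)
  show ?thesis
  proof (rule petersen_pattern[of U m])
    show "U i \<subseteq> verts G" if "i < 10" for i by (rule U(1)[OF that])
    show "card (U i) = m" if "i < 10" for i by (rule U(2)[OF that])
    show "U i \<inter> U j = {}" if "i < 10" "j < 10" "i \<noteq> j" for i j by (rule U(3)[OF that])
    show "0 < m" by (rule m(1))
    show "2 * harm m * \<alpha> \<le> p\<^sup>2 * m / 2 ^ 22" by (rule small)
    fix x y
    assume x: "\<And>i. i < 5 \<Longrightarrow> x i \<in> U i" and y: "\<And>i. i < 5 \<Longrightarrow> y i \<in> U (i + 5)"
      and edges: "\<And>i. i < 5 \<Longrightarrow> {x i, x ((i + 1) mod 5)} \<in> edges G"
        "\<And>i. i < 5 \<Longrightarrow> {y i, y ((i + 2) mod 5)} \<in> edges G"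
        "\<And>i. i < 5 \<Longrightarrow> {x i, y i} \<in> edges G"
    define z where "z = (\<lambda>i. if i < 5 then x i else y (i - 5))"
    have zU: "z i \<in> U i" if "i < 10" for i
    proof (cases "i < 5")
      case False
      then have "y (i - 5) \<in> U (i - 5 + 5)" using that by (intro y) simp
      then show ?thesis using False by (simp add: z_def)
    qed (use x in \<open>simp add: z_def\<close>)
    show ?thesis
    proof (rule contains_petersen[of z])
      show "inj_on z {..<10}"
      proof (rule inj_onI)
        fix i j assume ij: "i \<in> {..<10::nat}" "j \<in> {..<10::nat}" "z i = z j"
        show "i = j"
        proof (rule ccontr)
          assume "i \<noteq> j"
          then have "U i \<inter> U j = {}" using U(3) ij by simp
          then show False using zU[of i] zU[of j] ij by auto
        qed
      qed
      show "z i \<in> verts G" if "i < 10" for i using zU[OF that] U(1)[OF that] by blast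
    qed (use edges in \<open>auto simp: z_def\<close>)
  qed
qed

section \<open>The exponent\<close>

text \<open>The increment \<open>1 / (n + 1)\<close> of \<open>harm\<close> is at most that of
  \<open>ln\<close>, by \<open>ln x <= x - 1\<close> at \<open>x = n / (n + 1)\<close>.\<close>

lemma harm_le_ln: "0 < n \<Longrightarrow> harm n \<le> 1 + ln (real n)"
proof (induction n rule: nat_induct_non_zero)
  case 1
  then show ?case by (simp add: harm_def)
next
  case (Suc n)
  have "ln (real n / real (Suc n)) \<le> real n / real (Suc n) - 1"
    using Suc.hyps by (intro ln_le_minus_one) simp
  moreover have "real n / real (Suc n) - 1 = - inverse (real (Suc n))"
    by (simp add: field_simps)
  moreover have "ln (real n / real (Suc n)) = ln (real n) - ln (real (Suc n))"
    using Suc.hyps by (simp add: ln_div)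
  ultimately show ?case using Suc.IH by (simp add: harm_Suc)
qed

text \<open>Jumbledness is applied with both sets equal to \<open>verts G\<close>, where every edge
  is counted at least once.\<close>

lemma edges_le_if_jumbled:
  assumes "simple_graph G" "jumbled G p \<alpha>" "card (verts G) = n"
  shows "real (card (edges G)) \<le> p * real n ^ 2 + \<alpha> * real n"
proof -
  have "e \<in> edges G \<Longrightarrow> \<exists>x\<in>verts G. \<exists>y\<in>verts G. e = {x, y}" for e
    using assms(1) unfolding simple_graph_def card_2_iff by fastforce
  then have "{e \<in> edges G. \<exists>x\<in>verts G. \<exists>y\<in>verts G. e = {x, y}} = edges G" by blast
  then have "card (edges G) \<le> edges_between G (verts G) (verts G)"
    by (simp add: edges_between_def)
  moreover have "\<bar>real (edges_between G (verts G) (verts G)) - p * n * n\<bar> \<le> \<alpha> * sqrt (real n * real n)"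
    using assms(2,3) unfolding jumbled_def by blast
  ultimately show ?thesis by (simp add: power2_eq_square)
qed

text \<open>The quantifiers over \<open>G\<close>, \<open>p\<close> and \<open>\<alpha>\<close>
  stand inside the eventuality because the density may vary with \<open>n\<close>; the threshold for
  \<open>n\<close> depends on \<open>C\<close> and \<open>\<delta>\<close> only.\<close>

lemma eventually_petersen_free_edges_le:
  fixes C \<delta> :: real
  assumes "0 < C" "0 < \<delta>"
  shows "\<forall>\<^sub>F n in sequentially. \<forall>(G :: 'a ugraph) p \<alpha>.
    simple_graph G \<longrightarrow> card (verts G) = n \<longrightarrow> \<not> contains_subgraph G petersen \<longrightarrow>
    0 \<le> p \<longrightarrow> p \<le> 1 \<longrightarrow> 0 \<le> \<alpha> \<longrightarrow> \<alpha> \<le> C * sqrt (real n * p) \<longrightarrow> jumbled G p \<alpha> \<longrightarrow>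
    real (card (edges G)) \<le> (1 + C) * real n powr (5 / 3 + \<delta>)"
proof -
  \<comment> \<open>In the constant \<open>40 * 2 ^ 22\<close> below, 40 combines the 2 of
    \<open>2 * harm m\<close> with the 20 of \<open>m >= n / 20\<close>, and \<open>2 ^ 22\<close>
    is the constant of \<open>petersen_pattern\<close>.\<close>
  have "((\<lambda>n::nat. (1 + ln (real n)) / real n powr (3 * \<delta> / 2)) \<longlongrightarrow> 0) sequentially"
    using assms(2) by real_asymp
  moreover have "0 < 1 / (40 * 2 ^ 22 * C)" using assms(1) by simp
  ultimately have "\<forall>\<^sub>F n in sequentially. (1 + ln (real n)) / real n powr (3 * \<delta> / 2) < 1 / (40 * 2 ^ 22 * C)"
    by (rule order_tendstoD(2))
  then show ?thesis
    using eventually_ge_at_top[of "20 :: nat"]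
  proof eventually_elim
    case (elim n)
    then have n: "20 \<le> real n" by simp
    \<comment> \<open>For \<open>\<alpha>\<close> up to \<open>C * sqrt (n * p)\<close>, the
      smallness condition asks that \<open>p^(3/2) * n^(1/2)\<close> exceed a multiple of
      \<open>1 + ln n\<close>; at \<open>p = q\<close> this quantity is
      \<open>n^(3 * \<delta> / 2)\<close>.\<close>
    define q where "q = real n powr (- 1 / 3 + \<delta>)"
    have q0: "0 < q" using n by (simp add: q_def)
    have log: "40 * 2 ^ 22 * C * (1 + ln (real n)) \<le> real n powr (3 * \<delta> / 2)"
      using elim(1) n assms(1) by (simp add: field_simps)
    have q_sqrt: "q * sqrt q * sqrt (real n) = real n powr (3 * \<delta> / 2)"
    proof -
      have "q * sqrt q * sqrt (real n) = real n powr (- 1 / 3 + \<delta>) * real n powr ((- 1 / 3 + \<delta>) * (1 / 2)) * real n powr (1 / 2)"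
        using n by (simp add: q_def powr_half_sqrt[symmetric] powr_powr)
      also have "\<dots> = real n powr ((- 1 / 3 + \<delta>) + (- 1 / 3 + \<delta>) * (1 / 2) + 1 / 2)"
        by (simp only: powr_add)
      also have "(- 1 / 3 + \<delta>) + (- 1 / 3 + \<delta>) * (1 / 2) + 1 / 2 = 3 * \<delta> / 2"
        by (simp add: field_simps)
      finally show ?thesis .
    qed
    show ?case
    proof (intro allI impI)
      fix G :: "'a ugraph" and p \<alpha> :: real
      assume G: "simple_graph G" "card (verts G) = n" "\<not> contains_subgraph G petersen"
        and p: "0 \<le> p" "p \<le> 1" and \<alpha>: "0 \<le> \<alpha>" "\<alpha> \<le> C * sqrt (real n * p)" and jum: "jumbled G p \<alpha>"
      show "real (card (edges G)) \<le> (1 + C) * real n powr (5 / 3 + \<delta>)"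
      proof (cases "q \<le> p")
        case True
        define m where "m = n div 10"
        have m: "0 < m" "10 * m \<le> card (verts G)" "m \<le> n" using elim(2) G(2) by (auto simp: m_def)
        \<comment> \<open>Rounding loses less than 10, which is at most half of \<open>n\<close> as
          \<open>n\<close> is at least 20.\<close>
        have "n < 10 * m + 10" unfolding m_def by presburger
        then have m20: "real n / 20 \<le> real m" using n by linarith
        have "harm m \<le> (harm n :: real)" using m by (intro harm_mono) auto
        also have "\<dots> \<le> 1 + ln (real n)" using elim(2) by (intro harm_le_ln) auto
        finally have h: "harm m \<le> 1 + ln (real n)" .
        have "q * sqrt q \<le> p * sqrt p" using True q0 by (intro mult_mono) auto
        then have "real n powr (3 * \<delta> / 2) \<le> p * sqrt p * sqrt (real n)"
          unfolding q_sqrt[symmetric] by (intro mult_right_mono) auto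
        then have l: "40 * 2 ^ 22 * C * (1 + ln (real n)) \<le> p * sqrt p * sqrt (real n)"
          using log by linarith
        have "2 * harm m * \<alpha> \<le> 2 * (1 + ln (real n)) * (C * sqrt (real n * p))"
          using h \<alpha> n by (intro mult_mono) (auto simp: harm_nonneg)
        also have "\<dots> = (40 * 2 ^ 22 * C * (1 + ln (real n))) * (sqrt (real n) * sqrt p) / (20 * 2 ^ 22)"
          by (simp add: real_sqrt_mult)
        also have "\<dots> \<le> (p * sqrt p * sqrt (real n)) * (sqrt (real n) * sqrt p) / (20 * 2 ^ 22)"
          using l p by (intro divide_right_mono mult_right_mono) auto
        also have "\<dots> = p * (sqrt p * sqrt p) * (sqrt (real n) * sqrt (real n)) / (20 * 2 ^ 22)"
          by (simp only: mult_ac)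
        also have "\<dots> = p\<^sup>2 * (real n / 20) / 2 ^ 22"
          using p by (simp add: power2_eq_square)
        also have "\<dots> \<le> p\<^sup>2 * m / 2 ^ 22"
          using m20 by (intro divide_right_mono mult_left_mono) auto
        finally have "contains_subgraph G petersen"
          using True q0 p \<alpha> by (intro contains_petersen_if_jumbled[OF G(1) jum _ _ _ m(1,2)]) auto
        then show ?thesis using G(3) by blast
      next
        case False
        have qn: "q * real n = real n powr (2 / 3 + \<delta>)"
        proof -
          have "q * real n = real n powr (- 1 / 3 + \<delta>) * real n powr 1" using n by (simp add: q_def)
          also have "\<dots> = real n powr ((- 1 / 3 + \<delta>) + 1)" by (simp only: powr_add)
          finally show ?thesis by (simp add: add_ac)
        qed
        \<comment> \<open>Once \<open>q * n\<close> is at least 1 it dominates its square root, so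
          the jumbledness error is absorbed into the main term up to the factor
          \<open>C\<close>.\<close>
        have "1 \<le> q * real n" unfolding qn using n assms(2) by (intro ge_one_powr_ge_zero) auto
        then have "(q * real n) * 1 \<le> (q * real n) * (q * real n)" by (intro mult_left_mono) auto
        then have sq: "sqrt (real n * q) \<le> real n * q"
          using q0 n by (intro real_le_lsqrt) (auto simp: power2_eq_square mult_ac)
        have "sqrt (real n * p) \<le> sqrt (real n * q)" using False n by simp
        then have a: "C * sqrt (real n * p) \<le> C * (real n * q)"
          using assms(1) sq by (intro mult_left_mono order_trans[OF _ sq]) auto
        have "real (card (edges G)) \<le> p * real n ^ 2 + \<alpha> * real n"
          by (rule edges_le_if_jumbled[OF G(1) jum G(2)])
        also have "\<dots> \<le> q * real n ^ 2 + (C * (real n * q)) * real n"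
          using False \<alpha> a by (intro add_mono mult_right_mono) auto
        also have "\<dots> = (1 + C) * (q * real n * real n)"
          by (simp add: power2_eq_square algebra_simps)
        also have "q * real n * real n = real n powr (2 / 3 + \<delta>) * real n powr 1"
          unfolding qn using n by simp
        also have "\<dots> = real n powr (5 / 3 + \<delta>)"
          by (simp only: powr_add[symmetric]) (simp add: add_ac)
        finally show ?thesis .
      qed
    qed
  qed
qed

section \<open>From the edge bound to the exponent\<close>

lemma ex_rand_attained:
  fixes \<F> :: "'b ugraph set"
  assumes "\<And>H. H \<in> \<F> \<Longrightarrow> edges H \<noteq> {}"
  obtains G :: "nat ugraph" and p \<alpha> where "card (edges G) = ex_rand n C \<F>" "simple_graph G"
    "card (verts G) = n" "free_of G \<F>" "0 \<le> p" "p \<le> 1" "0 \<le> \<alpha>" "\<alpha> \<le> C * sqrt (real n * p)" "jumbled G p \<alpha>"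
proof -
  define Q where "Q = (\<lambda>G :: nat ugraph. simple_graph G \<and> card (verts G) = n \<and> free_of G \<F> \<and>
      (\<exists>p \<alpha>. 0 \<le> p \<and> p \<le> 1 \<and> 0 \<le> \<alpha> \<and> \<alpha> \<le> C * sqrt (real n * p) \<and> jumbled G p \<alpha>))"
  have ex: "ex_rand n C \<F> = Max {card (edges G) | G. Q G}"
    by (simp add: ex_rand_def Q_def)
  have "card (edges G) \<le> 2 ^ n" if "Q G" for G
  proof -
    have "finite (verts G)" "edges G \<subseteq> Pow (verts G)" "card (verts G) = n"
      using that by (auto simp: Q_def simple_graph_def)
    then show ?thesis by (metis card_Pow card_mono finite_Pow_iff)
  qed
  then have "{card (edges G) | G. Q G} \<subseteq> {..2 ^ n}" by auto
  then have fin: "finite {card (edges G) | G. Q G}" by (rule finite_subset) simp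
  \<comment> \<open>The edgeless graph is a candidate for every \<open>C\<close>, since at
    \<open>p = 0\<close> and \<open>\<alpha> = 0\<close> the condition on \<open>\<alpha>\<close>
    reads \<open>0 <= 0\<close>.\<close>
  define G0 :: "nat ugraph" where "G0 = \<lparr>verts = {..<n}, edges = {}\<rparr>"
  have "free_of G0 \<F>"
    using assms by (auto simp: free_of_def contains_subgraph_def G0_def)
  moreover have "jumbled G0 0 0" by (simp add: jumbled_def edges_between_def G0_def)
  then have "\<exists>p \<alpha>. 0 \<le> p \<and> p \<le> 1 \<and> 0 \<le> \<alpha> \<and> \<alpha> \<le> C * sqrt (real n * p) \<and> jumbled G0 p \<alpha>"
    by (intro exI[of _ 0]) simp
  ultimately have "Q G0" unfolding Q_def by (simp add: simple_graph_def G0_def)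
  then have "{card (edges G) | G. Q G} \<noteq> {}" by blast
  then have "ex_rand n C \<F> \<in> {card (edges G) | G. Q G}"
    unfolding ex using fin by (intro Max_in)
  then obtain G where "card (edges G) = ex_rand n C \<F>" "Q G" by auto
  then show thesis using that unfolding Q_def by blast
qed

lemma rand_exponent_at_petersen_le:
  assumes "0 < C" "0 < \<delta>"
  shows "rand_exponent_at C {petersen} \<le> ereal (2 / 3 + \<delta>)"
  unfolding rand_exponent_at_def
proof (rule Limsup_bounded)
  have "\<exists>A B. {{1, 2}, {3, 4}} = {A, B} \<and> A \<subseteq> {1..5 :: nat} \<and> card A = 2 \<and> B \<subseteq> {1..5} \<and> card B = 2 \<and> A \<inter> B = {}"
    by (rule exI[of _ "{1, 2}"], rule exI[of _ "{3, 4}"]) simp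
  then have "{{1, 2}, {3, 4}} \<in> edges petersen" by (simp add: petersen_def)
  then have "edges petersen \<noteq> {}" by blast
  \<comment> \<open>The edge bound is used with \<open>\<delta> / 2\<close>; the other half of
    \<open>\<delta>\<close> absorbs the constant \<open>1 + C\<close>.\<close>
  have "\<forall>\<^sub>F n in sequentially. (1 + C) * real n powr (5 / 3 + \<delta> / 2) \<le> real n powr (5 / 3 + \<delta>)"
    using assms by real_asymp
  moreover have "0 < \<delta> / 2" using assms by simp
  note eventually_petersen_free_edges_le[OF assms(1) this, where 'a = nat]
  ultimately show "\<forall>\<^sub>F n in sequentially. ext_log (real (ex_rand n C {petersen}) / real n) / ereal (ln (real n))
      \<le> ereal (2 / 3 + \<delta>)"
    using eventually_gt_at_top[of "1 :: nat"]
  proof eventually_elim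
    case (elim n)
    have ln: "0 < ln (real n)" using elim(3) by simp
    obtain G :: "nat ugraph" and p \<alpha> where G: "card (edges G) = ex_rand n C {petersen}" "simple_graph G"
      "card (verts G) = n" "free_of G {petersen}" "0 \<le> p" "p \<le> 1" "0 \<le> \<alpha>" "\<alpha> \<le> C * sqrt (real n * p)" "jumbled G p \<alpha>"
      using ex_rand_attained[of "{petersen}" n C] \<open>edges petersen \<noteq> {}\<close> by blast
    have "real (card (edges G)) \<le> (1 + C) * real n powr (5 / 3 + \<delta> / 2)"
      using elim(2) G by (auto simp: free_of_def)
    then have "real (ex_rand n C {petersen}) \<le> real n powr (5 / 3 + \<delta>)"
      using elim(1) G(1) by linarith
    then have "real (ex_rand n C {petersen}) / real n \<le> real n powr (5 / 3 + \<delta>) / real n powr 1"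
      using elim(3) by (simp add: divide_right_mono)
    also have "\<dots> = real n powr (2 / 3 + \<delta>)"
      by (simp only: powr_diff[symmetric]) (simp add: algebra_simps)
    finally have le: "real (ex_rand n C {petersen}) / real n \<le> real n powr (2 / 3 + \<delta>)" .
    show ?case
    \<comment> \<open>If \<open>ex_rand\<close> vanishes, \<open>ext_log\<close> is minus infinity
      and stays so after division by the positive \<open>ln n\<close>.\<close>
    proof (cases "real (ex_rand n C {petersen}) / real n \<le> 0")
      case True
      then show ?thesis using ln by (simp add: ext_log_def)
    next
      case False
      then have "ln (real (ex_rand n C {petersen}) / real n) \<le> ln (real n powr (2 / 3 + \<delta>))"
        using le elim(3) by (subst ln_le_cancel_iff) auto
      also have "\<dots> = (2 / 3 + \<delta>) * ln (real n)" using elim(3) by (simp add: ln_powr)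
      finally show ?thesis using False ln by (simp add: ext_log_def divide_le_eq)
    qed
  qed
qed

theorem theorem1p4:
  shows "rand_exponent {petersen} \<le> 2 / 3"
proof (rule tendsto_upperbound[OF tendsto_rand_exponent])
  have "rand_exponent_at C {petersen} \<le> 2 / 3" if "0 < C" for C
  proof (rule ereal_le_epsilon2)
    fix e :: real
    assume "0 < e"
    with that have "rand_exponent_at C {petersen} \<le> ereal (2 / 3 + e)"
      by (rule rand_exponent_at_petersen_le)
    also have "\<dots> = 2 / 3 + ereal e" by simp
    finally show "rand_exponent_at C {petersen} \<le> 2 / 3 + ereal e" .
  qed
  then show "\<forall>\<^sub>F C in at_top. rand_exponent_at C {petersen} \<le> 2 / 3"
    by (rule eventually_mono[OF eventually_gt_at_top])
qed simp

end
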